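(* For a given spray $\mathbf{G}$ and a given function $P$ (positively homogeneous of degree one in $y$), let $Q_o$ be a (nonzero) solution of the system $$Q_{;i}=Q_{.i;0},\qquad Q_{;0}=2PQ \qquad ( * )$$ in the class of functions positively homogeneous of degree one in $y$. Suppose that the spray $\bar G^i:=G^i+Py^i$ is of nonzero scalar curvature. Then any solution $Q$ of $( * )$ is given by $Q=cQ_o$ for some constant $c$; in other words, $\mathcal{H}_1^{-1}(P)$ has a unique element.
   Context: A spray on an $n$-dimensional manifold $M$ is a smooth vector field on a conical region of $TM\setminus\{0\}$ (an open set closed under $y\mapsto\lambda y$, $\lambda>0$), locally $\mathbf{G}=y^i\frac{\partial}{\partial x^i}-2G^i\frac{\partial}{\partial y^i}$ with $G^i$ positively homogeneous of degree two in $y$. Put $\partial_k=\partial/\partial x^k$, $\dot\partial_k=\partial/\partial y^k$, $G^r_i=\dot\partial_iG^r$, $G^r_{ij}=\dot\partial_j\dot\partial_iG^r$, $\delta_i=\partial_i-G^r_i\dot\partial_r$. For a function $f$: $f_{.i}=\dot\partial_if$, $f_{;i}=\delta_if$, $f_{;0}=f_{;i}y^i$, $f_{.i;j}=\delta_jf_{.i}-f_{.r}G^r_{ij}$, $f_{.i;0}=f_{.i;j}y^j$ (all with respect to $\mathbf{G}$). Riemann curvature of a spray: $R^i_{\ k}=2\partial_kG^i-y^j\partial_j\dot\partial_kG^i+2G^j\dot\partial_j\dot\partial_kG^i-(\dot\partial_jG^i)(\dot\partial_kG^j)$. The spray is of scalar curvature if $R^i_{\ k}=R\delta^i_k-\tau_ky^i$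 for some homogeneous functions $R(x,y),\tau_k(x,y)$; it is of nonzero scalar curvature if moreover its Ricci curvature $R^i_{\ i}=(n-1)R$ is nonzero. A Hamel function of $\mathbf{G}$ is a function $Q$, positively homogeneous of degree one in $y$, with $Q_{;i}=Q_{.i;0}$. For nonzero $Q$ homogeneous of degree one, $[Q]$ denotes the class of all functions $cQ$ with $c$ a nonzero constant, and $\mathcal{H}_1$ is the map $[Q]\mapsto \frac{Q_{;0}}{2Q}$ defined on classes of nonzero Hamel functions of $\mathbf{G}$.
   Formalization: The conical region on which the spray, P and the solutions live is assumed connected; on a disconnected region (e.g. over two disjoint round spheres) a solution can be rescaled on one component only, so uniqueness up to a single constant fails. *)

theory Defs
  imports "HOL-Analysis.Analysis"
begin

section \<open>Smooth manifolds and their tangent bundles\<close>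

text \<open>Smoothness on an open set \<open>S\<close>: Frechet derivatives of all orders exist and are continuous.\<close>

primrec C_k_on :: "nat \<Rightarrow> 'a::real_normed_vector set \<Rightarrow> ('a \<Rightarrow> 'b::real_normed_vector) \<Rightarrow> bool" where
  "C_k_on 0 S f \<longleftrightarrow> continuous_on S f"
| "C_k_on (Suc k) S f \<longleftrightarrow>
     (\<forall>x\<in>S. f differentiable (at x)) \<and> (\<forall>v. C_k_on k S (\<lambda>x. frechet_derivative f (at x) v))"

definition smooth_on :: "'a::real_normed_vector set \<Rightarrow> ('a \<Rightarrow> 'b::real_normed_vector) \<Rightarrow> bool" where
  "smooth_on S f \<longleftrightarrow> (\<forall>k. C_k_on k S f)"

text \<open>A chart is a domain together with a coordinate map; only the values of the
  map on the domain matter.\<close>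

type_synonym ('m, 'e) chart = "'m set \<times> ('m \<Rightarrow> 'e)"

definition chart_inv :: "('m, 'e) chart \<Rightarrow> 'e \<Rightarrow> 'm" where
  "chart_inv c = inv_into (fst c) (snd c)"

definition coord_image :: "'m set \<Rightarrow> ('m, 'e) chart \<Rightarrow> 'e set" where
  "coord_image D c = snd c ` (D \<inter> fst c)"

definition atlas_space :: "('m, 'e) chart set \<Rightarrow> 'm set" where
  "atlas_space A = (\<Union>c\<in>A. fst c)"

definition atlas_topology :: "('m, 'e::euclidean_space) chart set \<Rightarrow> 'm topology" where
  "atlas_topology A = topology (\<lambda>W. W \<subseteq> atlas_space A \<and> (\<forall>c\<in>A. open (coord_image W c)))"

text \<open>The manifold is the set \<open>atlas_space A\<close>, with the topology for which all charts are
  homeomorphisms onto open sets.\<close>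

definition smooth_manifold :: "('m, 'e::euclidean_space) chart set \<Rightarrow> bool" where
  "smooth_manifold A \<longleftrightarrow>
     (\<forall>c\<in>A. inj_on (snd c) (fst c) \<and> open (coord_image (fst c) c)) \<and>
     (\<forall>c\<in>A. \<forall>d\<in>A. open (coord_image (fst d) c) \<and>
        smooth_on (coord_image (fst d) c) (snd d \<circ> chart_inv c)) \<and>
     Hausdorff_space (atlas_topology A) \<and>
     second_countable (atlas_topology A)"

text \<open>A tangent vector at \<open>p\<close> is the family of its coordinate vectors in all charts around \<open>p\<close>,
  related by the differentials of the coordinate changes. The value \<open>0\<close> at the
  remaining charts makes the representation unique.\<close>

definition tangent_space :: "('m, 'e::euclidean_space) chart set \<Rightarrow> 'm \<Rightarrow> (('m, 'e) chart \<Rightarrow> 'e) set" where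
  "tangent_space A p = {v.
     (\<forall>c. \<not> (c \<in> A \<and> p \<in> fst c) \<longrightarrow> v c = 0) \<and>
     (\<forall>c\<in>A. \<forall>d\<in>A. p \<in> fst c \<inter> fst d \<longrightarrow>
        v d = frechet_derivative (snd d \<circ> chart_inv c) (at (snd c p)) (v c))}"

type_synonym ('m, 'e) tangent = "'m \<times> (('m, 'e) chart \<Rightarrow> 'e)"

definition lift_chart ::
  "('m, 'e::euclidean_space) chart set \<Rightarrow> ('m, 'e) chart \<Rightarrow> (('m, 'e) tangent, 'e \<times> 'e) chart" where
  "lift_chart A c = (Sigma (fst c) (tangent_space A), \<lambda>(p, v). (snd c p, v c))"

definition tangent_atlas ::
  "('m, 'e::euclidean_space) chart set \<Rightarrow> (('m, 'e) tangent, 'e \<times> 'e) chart set" where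
  "tangent_atlas A = lift_chart A ` A"

definition smooth_vector_field ::
  "('m, 'e::euclidean_space) chart set \<Rightarrow> 'm set \<Rightarrow> ('m \<Rightarrow> ('m, 'e) chart \<Rightarrow> 'e) \<Rightarrow> bool" where
  "smooth_vector_field A D X \<longleftrightarrow>
     (\<forall>p\<in>D. X p \<in> tangent_space A p) \<and>
     (\<forall>c\<in>A. smooth_on (coord_image D c) (\<lambda>z. X (chart_inv c z) c))"

definition conical_region ::
  "('m, 'e::euclidean_space) chart set \<Rightarrow> ('m, 'e) tangent set \<Rightarrow> bool" where
  "conical_region A D \<longleftrightarrow>
     openin (atlas_topology (tangent_atlas A)) D \<and>
     connectedin (atlas_topology (tangent_atlas A)) D \<and>
     (\<forall>(p, v)\<in>D. v \<noteq> (\<lambda>_. 0) \<and> (\<forall>t>0. (p, \<lambda>c. t *\<^sub>R v c) \<in> D))"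

section \<open>Functions and sprays on a conical region\<close>

type_synonym 'n coords = "(real ^ 'n) \<times> (real ^ 'n)"

text \<open>The coordinates \<open>(x, y)\<close> of the points of \<open>D\<close> in the bundle chart induced by \<open>c\<close>, and the
  local expression of a function on \<open>D\<close> in these coordinates.\<close>

definition coord_dom ::
  "('m, real ^ 'n) chart set \<Rightarrow> ('m, real ^ 'n) tangent set \<Rightarrow> ('m, real ^ 'n) chart \<Rightarrow> 'n coords set" where
  "coord_dom A D c = coord_image D (lift_chart A c)"

definition local_rep ::
  "('m, real ^ 'n) chart set \<Rightarrow> (('m, real ^ 'n) tangent \<Rightarrow> 'b) \<Rightarrow> ('m, real ^ 'n) chart \<Rightarrow> 'n coords \<Rightarrow> 'b" where
  "local_rep A f c = f \<circ> chart_inv (lift_chart A c)"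

definition pos_homogeneous_on :: "'n coords set \<Rightarrow> nat \<Rightarrow> ('n::finite coords \<Rightarrow> 'b::real_vector) \<Rightarrow> bool" where
  "pos_homogeneous_on S k f \<longleftrightarrow> (\<forall>(x, y)\<in>S. \<forall>t>0. f (x, t *\<^sub>R y) = t ^ k *\<^sub>R f (x, y))"

definition homogeneous_one ::
  "('m, real ^ 'n) chart set \<Rightarrow> ('m, real ^ 'n) tangent set \<Rightarrow> (('m, real ^ 'n) tangent \<Rightarrow> real) \<Rightarrow> bool" where
  "homogeneous_one A D f \<longleftrightarrow>
     (\<forall>c\<in>A. smooth_on (coord_dom A D c) (local_rep A f c) \<and>
            pos_homogeneous_on (coord_dom A D c) 1 (local_rep A f c))"

text \<open>The coefficients \<open>G\<^sup>i\<close> of a vector field \<open>y\<^sup>i \<partial>/\<partial>x\<^sup>i - 2 G\<^sup>i \<partial>/\<partial>y\<^sup>i\<close> in the chart \<open>c\<close>.\<close>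

definition spray_coeff ::
  "('m, real ^ 'n) chart set \<Rightarrow>
   (('m, real ^ 'n) tangent \<Rightarrow> (('m, real ^ 'n) tangent, 'n coords) chart \<Rightarrow> 'n coords) \<Rightarrow>
   ('m, real ^ 'n) chart \<Rightarrow> 'n coords \<Rightarrow> real ^ 'n" where
  "spray_coeff A X c = (\<lambda>z. - (1/2) *\<^sub>R snd (local_rep A X c z (lift_chart A c)))"

definition spray ::
  "('m, real ^ 'n) chart set \<Rightarrow> ('m, real ^ 'n) tangent set \<Rightarrow>
   (('m, real ^ 'n) tangent \<Rightarrow> (('m, real ^ 'n) tangent, 'n coords) chart \<Rightarrow> 'n coords) \<Rightarrow> bool" where
  "spray A D X \<longleftrightarrow>
     smooth_vector_field (tangent_atlas A) D X \<and>
     (\<forall>c\<in>A. (\<forall>z\<in>coord_dom A D c. fst (local_rep A X c z (lift_chart A c)) = snd z) \<and>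
            pos_homogeneous_on (coord_dom A D c) 2 (spray_coeff A X c))"

section \<open>Local formulas\<close>

text \<open>In this section \<open>G\<close> and \<open>f\<close> are local expressions in coordinates \<open>z = (x, y)\<close>.\<close>

definition px :: "'n \<Rightarrow> ('n::finite coords \<Rightarrow> real) \<Rightarrow> 'n coords \<Rightarrow> real" where
  "px k f z = frechet_derivative f (at z) (axis k 1, 0)"

definition py :: "'n \<Rightarrow> ('n::finite coords \<Rightarrow> real) \<Rightarrow> 'n coords \<Rightarrow> real" where
  "py k f z = frechet_derivative f (at z) (0, axis k 1)"

text \<open>\<open>nonlin_conn G r i\<close> is \<open>G\<^sup>r\<^sub>i\<close> and \<open>berwald_conn G r i j\<close> is \<open>G\<^sup>r\<^sub>i\<^sub>j\<close>.\<close>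

definition nonlin_conn :: "('n::finite coords \<Rightarrow> real ^ 'n) \<Rightarrow> 'n \<Rightarrow> 'n \<Rightarrow> 'n coords \<Rightarrow> real" where
  "nonlin_conn G r i = py i (\<lambda>z. G z $ r)"

definition berwald_conn :: "('n::finite coords \<Rightarrow> real ^ 'n) \<Rightarrow> 'n \<Rightarrow> 'n \<Rightarrow> 'n \<Rightarrow> 'n coords \<Rightarrow> real" where
  "berwald_conn G r i j = py j (py i (\<lambda>z. G z $ r))"

text \<open>\<open>\<delta>\<^sub>i f = f\<^sub>;\<^sub>i\<close>\<close>

definition delta :: "('n::finite coords \<Rightarrow> real ^ 'n) \<Rightarrow> 'n \<Rightarrow> ('n coords \<Rightarrow> real) \<Rightarrow> 'n coords \<Rightarrow> real" where
  "delta G i f z = px i f z - (\<Sum>r\<in>UNIV. nonlin_conn G r i z * py r f z)"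

text \<open>\<open>f\<^sub>;\<^sub>0\<close>\<close>

definition delta0 :: "('n::finite coords \<Rightarrow> real ^ 'n) \<Rightarrow> ('n coords \<Rightarrow> real) \<Rightarrow> 'n coords \<Rightarrow> real" where
  "delta0 G f z = (\<Sum>i\<in>UNIV. delta G i f z * snd z $ i)"

text \<open>\<open>f\<^sub>.\<^sub>i\<^sub>;\<^sub>j\<close> and \<open>f\<^sub>.\<^sub>i\<^sub>;\<^sub>0\<close>\<close>

definition vdelta :: "('n::finite coords \<Rightarrow> real ^ 'n) \<Rightarrow> 'n \<Rightarrow> 'n \<Rightarrow> ('n coords \<Rightarrow> real) \<Rightarrow> 'n coords \<Rightarrow> real" where
  "vdelta G i j f z = delta G j (py i f) z - (\<Sum>r\<in>UNIV. py r f z * berwald_conn G r i j z)"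

definition vdelta0 :: "('n::finite coords \<Rightarrow> real ^ 'n) \<Rightarrow> 'n \<Rightarrow> ('n coords \<Rightarrow> real) \<Rightarrow> 'n coords \<Rightarrow> real" where
  "vdelta0 G i f z = (\<Sum>j\<in>UNIV. vdelta G i j f z * snd z $ j)"

text \<open>\<open>riemann G i k\<close> is \<open>R\<^sup>i\<^sub>k\<close>.\<close>

definition riemann :: "('n::finite coords \<Rightarrow> real ^ 'n) \<Rightarrow> 'n \<Rightarrow> 'n \<Rightarrow> 'n coords \<Rightarrow> real" where
  "riemann G i k z =
     2 * px k (\<lambda>w. G w $ i) z
     - (\<Sum>j\<in>UNIV. snd z $ j * px j (py k (\<lambda>w. G w $ i)) z)
     + 2 * (\<Sum>j\<in>UNIV. G z $ j * py j (py k (\<lambda>w. G w $ i)) z)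
     - (\<Sum>j\<in>UNIV. py j (\<lambda>w. G w $ i) z * py k (\<lambda>w. G w $ j) z)"

definition ricci :: "('n::finite coords \<Rightarrow> real ^ 'n) \<Rightarrow> 'n coords \<Rightarrow> real" where
  "ricci G z = (\<Sum>i\<in>UNIV. riemann G i i z)"

section \<open>Scalar curvature and Hamel functions\<close>

text \<open>Here \<open>G\<close> assigns to each chart the local coefficients of a spray. \<open>R\<close> is a function on \<open>D\<close>,
  whereas the \<open>\<tau>\<^sub>k\<close> are components relative to a chart. Their degrees of homogeneity are
  those forced by \<open>R\<^sup>i\<^sub>k\<close> being homogeneous of degree two.\<close>

definition scalar_curvature ::
  "('m, real ^ 'n) chart set \<Rightarrow> ('m, real ^ 'n) tangent set \<Rightarrow>
   (('m, real ^ 'n) chart \<Rightarrow> 'n coords \<Rightarrow> real ^ 'n) \<Rightarrow> bool" where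
  "scalar_curvature A D G \<longleftrightarrow>
     (\<exists>(R :: ('m, real ^ 'n) tangent \<Rightarrow> real) (\<tau> :: ('m, real ^ 'n) chart \<Rightarrow> 'n coords \<Rightarrow> real ^ 'n).
        \<forall>c\<in>A. pos_homogeneous_on (coord_dom A D c) 2 (local_rep A R c) \<and>
              pos_homogeneous_on (coord_dom A D c) 1 (\<tau> c) \<and>
              (\<forall>z\<in>coord_dom A D c. \<forall>i k.
                 riemann (G c) i k z =
                   local_rep A R c z * (if i = k then 1 else 0) - \<tau> c z $ k * snd z $ i))"

definition nonzero_scalar_curvature ::
  "('m, real ^ 'n) chart set \<Rightarrow> ('m, real ^ 'n) tangent set \<Rightarrow>
   (('m, real ^ 'n) chart \<Rightarrow> 'n coords \<Rightarrow> real ^ 'n) \<Rightarrow> bool" where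
  "nonzero_scalar_curvature A D G \<longleftrightarrow>
     scalar_curvature A D G \<and> (\<forall>c\<in>A. \<forall>z\<in>coord_dom A D c. ricci (G c) z \<noteq> 0)"

definition hamel_function ::
  "('m, real ^ 'n) chart set \<Rightarrow> ('m, real ^ 'n) tangent set \<Rightarrow>
   (('m, real ^ 'n) tangent \<Rightarrow> (('m, real ^ 'n) tangent, 'n coords) chart \<Rightarrow> 'n coords) \<Rightarrow>
   (('m, real ^ 'n) tangent \<Rightarrow> real) \<Rightarrow> bool" where
  "hamel_function A D X Q \<longleftrightarrow>
     homogeneous_one A D Q \<and>
     (\<forall>c\<in>A. \<forall>z\<in>coord_dom A D c. \<forall>i.
        delta (spray_coeff A X c) i (local_rep A Q c) z = vdelta0 (spray_coeff A X c) i (local_rep A Q c) z)"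

definition hamel_system ::
  "('m, real ^ 'n) chart set \<Rightarrow> ('m, real ^ 'n) tangent set \<Rightarrow>
   (('m, real ^ 'n) tangent \<Rightarrow> (('m, real ^ 'n) tangent, 'n coords) chart \<Rightarrow> 'n coords) \<Rightarrow>
   (('m, real ^ 'n) tangent \<Rightarrow> real) \<Rightarrow> (('m, real ^ 'n) tangent \<Rightarrow> real) \<Rightarrow> bool" where
  "hamel_system A D X P Q \<longleftrightarrow>
     hamel_function A D X Q \<and>
     (\<forall>c\<in>A. \<forall>z\<in>coord_dom A D c.
        delta0 (spray_coeff A X c) (local_rep A Q c) z = 2 * local_rep A P c z * local_rep A Q c z)"

text \<open>The class \<open>[Q]\<close>. Functions on \<open>D\<close> are restricted to \<open>D\<close> so that their
  values elsewhere do not distinguish them.\<close>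

definition fun_class :: "'p set \<Rightarrow> ('p \<Rightarrow> real) \<Rightarrow> ('p \<Rightarrow> real) set" where
  "fun_class D Q = {restrict (\<lambda>p. c * Q p) D | c. c \<noteq> 0}"

text \<open>\<open>H\<^sub>1\<close> divides by \<open>Q\<close>, so a nonzero Hamel function is one without zeros.\<close>

definition hamel_classes ::
  "('m, real ^ 'n) chart set \<Rightarrow> ('m, real ^ 'n) tangent set \<Rightarrow>
   (('m, real ^ 'n) tangent \<Rightarrow> (('m, real ^ 'n) tangent, 'n coords) chart \<Rightarrow> 'n coords) \<Rightarrow>
   (('m, real ^ 'n) tangent \<Rightarrow> real) set set" where
  "hamel_classes A D X = {fun_class D Q | Q. hamel_function A D X Q \<and> (\<forall>\<xi>\<in>D. Q \<xi> \<noteq> 0)}"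

text \<open>\<open>H\<^sub>1\<close> sends a class to the function on \<open>D\<close> that is given by \<open>Q\<^sub>;\<^sub>0 / (2 Q)\<close> for all
  representatives \<open>Q\<close> and in all charts.\<close>

definition H1 ::
  "('m, real ^ 'n) chart set \<Rightarrow> ('m, real ^ 'n) tangent set \<Rightarrow>
   (('m, real ^ 'n) tangent \<Rightarrow> (('m, real ^ 'n) tangent, 'n coords) chart \<Rightarrow> 'n coords) \<Rightarrow>
   (('m, real ^ 'n) tangent \<Rightarrow> real) set \<Rightarrow> ('m, real ^ 'n) tangent \<Rightarrow> real" where
  "H1 A D X C = (THE F. F \<in> extensional D \<and>
     (\<forall>Q\<in>C. \<forall>c\<in>A. \<forall>z\<in>coord_dom A D c.
        local_rep A F c z =
          delta0 (spray_coeff A X c) (local_rep A Q c) z / (2 * local_rep A Q c z)))"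

end

theory Submission
  imports Defs
begin

text \<open>The system says that \<open>Q\<close> is parallel for the spray \<open>H = G + P y\<close>. Differentiating \<open>Q\<^sub>;\<^sub>0\<close> along
the fibre gives \<open>(Q\<^sub>;\<^sub>0)\<^sub>.\<^sub>i = Q\<^sub>;\<^sub>i + Q\<^sub>.\<^sub>i\<^sub>;\<^sub>0\<close> (\<open>delta_plus_vdelta0\<close>), so a Hamel function satisfies
\<open>2 Q\<^sub>;\<^sub>i = (Q\<^sub>;\<^sub>0)\<^sub>.\<^sub>i\<close>. For a solution this becomes \<open>Q\<^sub>;\<^sub>i = (P Q)\<^sub>.\<^sub>i\<close>, which is exactly what the passage from \<open>G\<close>
to \<open>H\<close> subtracts from \<open>Q\<^sub>;\<^sub>i\<close>. Hence all horizontal derivatives of \<open>Q\<close> with respect to \<open>H\<close>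
vanish (\<open>hamel_parallel\<close>).

Curvature then controls the vertical derivatives. A parallel function satisfies
\<open>R\<^sup>r\<^sub>k Q\<^sub>.\<^sub>r = 0\<close> (\<open>riemann_parallel\<close>), where \<open>R\<^sup>r\<^sub>k\<close> is the curvature of \<open>H\<close>. For
\<open>R\<^sup>r\<^sub>k = R \<delta>\<^sup>r\<^sub>k - \<tau>\<^sub>k y\<^sup>r\<close> this reads \<open>R Q\<^sub>.\<^sub>k = \<tau>\<^sub>k Q\<close> by Euler's relation, and \<open>R \<noteq> 0\<close>. So all
first derivatives of \<open>Q\<close> have the form \<open>dQ = Q L\<close>, with a locally bounded covector field \<open>L\<close> that depends on
\<open>H\<close> only (\<open>parallel_log_derivative\<close>).

If \<open>Q\<close> and \<open>Q'\<close> solve the system and \<open>k\<close> is a constant, then \<open>W = Q - k Q'\<close> also satisfies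
\<open>dW = W L\<close>. The zero set of such a \<open>W\<close> is closed, and open by the mean value theorem
(\<open>open_zero_set\<close>). As the conical region is connected, \<open>W\<close> vanishes
everywhere as soon as it vanishes at one point (\<open>hamel_ratio_propagates\<close>). Choosing \<open>k\<close> to match the
values at a point where \<open>Q\<^sub>o \<noteq> 0\<close> gives \<open>Q = k Q\<^sub>o\<close>, and \<open>k = 0\<close> shows that \<open>Q\<^sub>o\<close> has no zeros.

For the statement about classes, the definite description in the definition of \<open>H1\<close> has to
be justified. The function \<open>Q\<^sub>;\<^sub>0\<close> is the derivative of \<open>Q\<close> along the spray vector field, and is therefore
the same in all charts (\<open>dir_deriv_chart_independent\<close>). Consequently \<open>H1\<close> maps the class of
a Hamel function \<open>Q\<close> without zeros to \<open>P\<close> precisely when \<open>Q\<close> solves the system (\<open>H1_eq_iff\<close>).\<close>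

section \<open>Calculus of smooth functions\<close>

definition dir_deriv :: "'a::real_normed_vector \<Rightarrow> ('a \<Rightarrow> 'b::real_normed_vector) \<Rightarrow> 'a \<Rightarrow> 'b" where
  "dir_deriv u f z = frechet_derivative f (at z) u"

lemma dir_deriv_eq: "(f has_derivative f') (at z) \<Longrightarrow> dir_deriv u f z = f' u"
  using frechet_derivative_at[of f f' z] by (simp add: dir_deriv_def)

lemma has_derivative_dir_deriv:
  "f differentiable (at z) \<Longrightarrow> (f has_derivative (\<lambda>u. dir_deriv u f z)) (at z)"
  unfolding dir_deriv_def using frechet_derivative_works by metis

lemma dir_deriv_cong:
  assumes "open S" "z \<in> S" "\<And>w. w \<in> S \<Longrightarrow> f w = g w"
  shows "dir_deriv u f z = dir_deriv u g z"
proof -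
  have "(f has_derivative h) (at z) = (g has_derivative h) (at z)" for h
    using assms has_derivative_transform_within_open[of f h z UNIV S g]
      has_derivative_transform_within_open[of g h z UNIV S f] by auto
  then show ?thesis by (simp add: dir_deriv_def frechet_derivative_def)
qed

lemma linear_dir_deriv: "f differentiable (at z) \<Longrightarrow> linear (\<lambda>u. dir_deriv u f z)"
  unfolding dir_deriv_def by (metis eta_contract_eq linear_frechet_derivative)

lemma dir_deriv_add:
  "f differentiable (at z) \<Longrightarrow> g differentiable (at z) \<Longrightarrow>
    dir_deriv u (\<lambda>w. f w + g w) z = dir_deriv u f z + dir_deriv u g z"
  by (rule dir_deriv_eq[where f' = "\<lambda>u. dir_deriv u f z + dir_deriv u g z"])
     (intro has_derivative_add has_derivative_dir_deriv)

lemma dir_deriv_diff: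
  "f differentiable (at z) \<Longrightarrow> g differentiable (at z) \<Longrightarrow>
    dir_deriv u (\<lambda>w. f w - g w) z = dir_deriv u f z - dir_deriv u g z"
  by (rule dir_deriv_eq[where f' = "\<lambda>u. dir_deriv u f z - dir_deriv u g z"])
     (intro has_derivative_diff has_derivative_dir_deriv)

lemma dir_deriv_mult:
  fixes f g :: "'a::real_normed_vector \<Rightarrow> real"
  shows "f differentiable (at z) \<Longrightarrow> g differentiable (at z) \<Longrightarrow>
    dir_deriv u (\<lambda>w. f w * g w) z = f z * dir_deriv u g z + dir_deriv u f z * g z"
  by (rule dir_deriv_eq[where f' = "\<lambda>u. f z * dir_deriv u g z + dir_deriv u f z * g z"])
     (intro has_derivative_mult has_derivative_dir_deriv)

lemma dir_deriv_cmult: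
  fixes f :: "'a::real_normed_vector \<Rightarrow> real"
  shows "f differentiable (at z) \<Longrightarrow> dir_deriv u (\<lambda>w. a * f w) z = a * dir_deriv u f z"
  by (rule dir_deriv_eq[where f' = "\<lambda>u. a * dir_deriv u f z"])
     (intro has_derivative_mult_right has_derivative_dir_deriv)

lemma dir_deriv_sum:
  "(\<And>i. i \<in> I \<Longrightarrow> f i differentiable (at z)) \<Longrightarrow>
    dir_deriv u (\<lambda>w. \<Sum>i\<in>I. f i w) z = (\<Sum>i\<in>I. dir_deriv u (f i) z)"
  by (rule dir_deriv_eq[where f' = "\<lambda>u. \<Sum>i\<in>I. dir_deriv u (f i) z"])
     (intro has_derivative_sum has_derivative_dir_deriv)

lemma dir_deriv_linear: "bounded_linear L \<Longrightarrow> dir_deriv u L z = L u"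
  by (rule dir_deriv_eq) (rule bounded_linear_imp_has_derivative)

lemma C_k_on_cong:
  assumes "open S" "\<And>z. z \<in> S \<Longrightarrow> f z = g z"
  shows "C_k_on k S f \<longleftrightarrow> C_k_on k S g"
  using assms(2)
proof (induction k arbitrary: f g)
  case 0
  then show ?case by (simp cong: continuous_on_cong)
next
  case (Suc k)
  have d: "f differentiable (at z) \<longleftrightarrow> g differentiable (at z)" if "z \<in> S" for z
    unfolding differentiable_def
    using Suc.prems that assms(1) has_derivative_transform_within_open[of f _ z UNIV S g]
      has_derivative_transform_within_open[of g _ z UNIV S f] by auto
  have "C_k_on k S (\<lambda>x. dir_deriv v f x) \<longleftrightarrow> C_k_on k S (\<lambda>x. dir_deriv v g x)" for v
    by (rule Suc.IH) (rule dir_deriv_cong[OF assms(1)], use Suc.prems in auto)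
  then show ?case using d by (auto simp: dir_deriv_def)
qed

lemma smooth_on_differentiable: "smooth_on S f \<Longrightarrow> z \<in> S \<Longrightarrow> f differentiable (at z)"
  unfolding smooth_on_def by (metis C_k_on.simps(2))

lemma smooth_on_dir_deriv: "smooth_on S f \<Longrightarrow> smooth_on S (dir_deriv v f)"
  unfolding smooth_on_def dir_deriv_def[abs_def] by (metis C_k_on.simps(2))

lemma smooth_on_continuous: "smooth_on S f \<Longrightarrow> continuous_on S f"
  unfolding smooth_on_def by (metis C_k_on.simps(1))

lemma C_k_on_add:
  assumes "open S"
  shows "C_k_on k S f \<Longrightarrow> C_k_on k S g \<Longrightarrow> C_k_on k S (\<lambda>z. f z + g z)"
proof (induction k arbitrary: f g)
  case 0
  then show ?case by (simp add: continuous_on_add)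
next
  case (Suc k)
  have d: "f differentiable (at z)" "g differentiable (at z)" if "z \<in> S" for z
    using Suc.prems that by auto
  have "C_k_on k S (dir_deriv v (\<lambda>z. f z + g z))" for v
    using Suc.IH[of "dir_deriv v f" "dir_deriv v g"] Suc.prems
      C_k_on_cong[OF assms, of "dir_deriv v (\<lambda>z. f z + g z)" "\<lambda>z. dir_deriv v f z + dir_deriv v g z"]
    by (auto simp: dir_deriv_def[abs_def] dir_deriv_add[OF d, unfolded dir_deriv_def[abs_def]])
  then show ?case using d by (auto simp: dir_deriv_def[abs_def])
qed

lemma C_k_on_const: "C_k_on k S (\<lambda>z. a)"
  by (induction k arbitrary: a) auto

lemma smooth_on_add: "open S \<Longrightarrow> smooth_on S f \<Longrightarrow> smooth_on S g \<Longrightarrow> smooth_on S (\<lambda>z. f z + g z)"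
  by (simp add: smooth_on_def C_k_on_add)

lemma smooth_on_bounded_linear:
  assumes "bounded_linear L"
  shows "smooth_on S L"
  unfolding smooth_on_def
proof
  fix k
  have "dir_deriv v L = (\<lambda>z. L v)" for v
    using dir_deriv_linear[OF assms] by auto
  then show "C_k_on k S L"
    using assms linear_continuous_on[OF assms] bounded_linear_imp_differentiable[OF assms]
    by (cases k) (auto simp: C_k_on_const dir_deriv_def[abs_def])
qed

lemma smooth_on_linear_image:
  assumes "open S" "bounded_linear L" "smooth_on S f"
  shows "smooth_on S (\<lambda>z. L (f z))"
  unfolding smooth_on_def
proof
  fix k
  show "C_k_on k S (\<lambda>z. L (f z))" using assms(3)
  proof (induction k arbitrary: f)
    case 0
    then show ?case
      by (simp add: continuous_on_compose2[OF linear_continuous_on[OF assms(2), of UNIV]]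
          smooth_on_continuous)
  next
    case (Suc k)
    have h: "((\<lambda>w. L (f w)) has_derivative (\<lambda>u. L (dir_deriv u f z))) (at z)" if "z \<in> S" for z
      by (intro bounded_linear.has_derivative[OF assms(2)] has_derivative_dir_deriv
          smooth_on_differentiable[OF Suc.prems that])
    have "C_k_on k S (dir_deriv v (\<lambda>z. L (f z)))" for v
      using Suc.IH[OF smooth_on_dir_deriv[OF Suc.prems]]
      by (subst C_k_on_cong[OF assms(1) dir_deriv_eq[OF h]])
    then show ?case using h by (auto simp: dir_deriv_def[abs_def] differentiable_def)
  qed
qed

lemma smooth_on_mult:
  fixes f g :: "'a::real_normed_vector \<Rightarrow> real"
  assumes "open S" "smooth_on S f" "smooth_on S g"
  shows "smooth_on S (\<lambda>z. f z * g z)"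
  unfolding smooth_on_def
proof
  fix k
  show "C_k_on k S (\<lambda>z. f z * g z)" using assms(2,3)
  proof (induction k arbitrary: f g)
    case 0
    then show ?case by (simp add: continuous_on_mult smooth_on_continuous)
  next
    case (Suc k)
    have d: "f differentiable (at z)" "g differentiable (at z)" if "z \<in> S" for z
      using Suc.prems that smooth_on_differentiable by auto
    have "C_k_on k S (dir_deriv v (\<lambda>z. f z * g z))" for v
      by (subst C_k_on_cong[OF assms(1) dir_deriv_mult[OF d]])
        (auto intro!: C_k_on_add[OF assms(1)] Suc.IH Suc.prems smooth_on_dir_deriv)
    then show ?case using d by (auto simp: dir_deriv_def[abs_def])
  qed
qed

text \<open>The mean value theorem is applied twice: to the increment of \<open>f\<close> in direction \<open>v\<close>, as a
function of the displacement along \<open>u\<close>, and then to the derivative that this produces.\<close>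

lemma second_difference_mean_value:
  fixes f :: "'a::real_normed_vector \<Rightarrow> real"
  assumes S: "smooth_on S f" and h: "0 < h"
    and inS: "\<And>s t. 0 \<le> s \<Longrightarrow> s \<le> h \<Longrightarrow> 0 \<le> t \<Longrightarrow> t \<le> h \<Longrightarrow> z + s *\<^sub>R u + t *\<^sub>R v \<in> S"
  shows "\<exists>s t. 0 \<le> s \<and> s \<le> h \<and> 0 \<le> t \<and> t \<le> h \<and>
    f (z + h *\<^sub>R u + h *\<^sub>R v) - f (z + h *\<^sub>R u) - f (z + h *\<^sub>R v) + f z =
      h * h * dir_deriv v (dir_deriv u f) (z + s *\<^sub>R u + t *\<^sub>R v)"
proof -
  have line: "((\<lambda>r. g (p + r *\<^sub>R w)) has_real_derivative dir_deriv w g (p + r *\<^sub>R w)) (at r)"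
    if "g differentiable (at (p + r *\<^sub>R w))" for g :: "'a \<Rightarrow> real" and p w r
  proof -
    have "((\<lambda>r. p + r *\<^sub>R w) has_derivative (\<lambda>r. r *\<^sub>R w)) (at r)"
      by (auto intro!: derivative_eq_intros)
    from has_derivative_compose[OF this has_derivative_dir_deriv[OF that]]
    show ?thesis
      unfolding has_field_derivative_def
      by (simp add: linear_cmul[OF linear_dir_deriv[OF that]] mult.commute[of _ "dir_deriv _ _ _"])
  qed
  have fd: "f differentiable (at (z + s *\<^sub>R u + t *\<^sub>R v))"
    and fdd: "dir_deriv u f differentiable (at (z + s *\<^sub>R u + t *\<^sub>R v))"
    if "0 \<le> s" "s \<le> h" "0 \<le> t" "t \<le> h" for s t
    using smooth_on_differentiable[OF S inS[OF that]]
      smooth_on_differentiable[OF smooth_on_dir_deriv[OF S] inS[OF that]] by auto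
  have "\<exists>s. s > 0 \<and> s < h \<and>
      (f (z + h *\<^sub>R v + h *\<^sub>R u) - f (z + h *\<^sub>R u)) - (f (z + h *\<^sub>R v + 0 *\<^sub>R u) - f (z + 0 *\<^sub>R u)) =
      (h - 0) * (dir_deriv u f (z + h *\<^sub>R v + s *\<^sub>R u) - dir_deriv u f (z + s *\<^sub>R u))"
  proof (rule MVT2[OF h, of "\<lambda>s. f (z + h *\<^sub>R v + s *\<^sub>R u) - f (z + s *\<^sub>R u)"])
    fix s assume "0 \<le> s" "s \<le> h"
    then show "((\<lambda>s. f (z + h *\<^sub>R v + s *\<^sub>R u) - f (z + s *\<^sub>R u)) has_real_derivative
        dir_deriv u f (z + h *\<^sub>R v + s *\<^sub>R u) - dir_deriv u f (z + s *\<^sub>R u)) (at s)"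
      using fd[of s h] fd[of s 0] h by (intro DERIV_diff line) (auto simp: algebra_simps)
  qed
  then obtain s where s: "0 < s" "s < h" and
    e1: "(f (z + h *\<^sub>R v + h *\<^sub>R u) - f (z + h *\<^sub>R u)) - (f (z + h *\<^sub>R v) - f z) =
      h * (dir_deriv u f (z + h *\<^sub>R v + s *\<^sub>R u) - dir_deriv u f (z + s *\<^sub>R u))"
    by auto
  have "\<exists>t. t > 0 \<and> t < h \<and>
      dir_deriv u f (z + s *\<^sub>R u + h *\<^sub>R v) - dir_deriv u f (z + s *\<^sub>R u + 0 *\<^sub>R v) =
      (h - 0) * dir_deriv v (dir_deriv u f) (z + s *\<^sub>R u + t *\<^sub>R v)"
    by (rule MVT2[OF h, of "\<lambda>t. dir_deriv u f (z + s *\<^sub>R u + t *\<^sub>R v)"], rule line)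
       (use fdd s in auto)
  then obtain t where "0 < t" "t < h" and
    e2: "dir_deriv u f (z + s *\<^sub>R u + h *\<^sub>R v) - dir_deriv u f (z + s *\<^sub>R u) =
      h * dir_deriv v (dir_deriv u f) (z + s *\<^sub>R u + t *\<^sub>R v)"
    by auto
  have "f (z + h *\<^sub>R u + h *\<^sub>R v) - f (z + h *\<^sub>R u) - f (z + h *\<^sub>R v) + f z =
      h * h * dir_deriv v (dir_deriv u f) (z + s *\<^sub>R u + t *\<^sub>R v)"
    using e1 unfolding mult.assoc e2[symmetric] by (simp add: algebra_simps)
  then show ?thesis using s \<open>0 < t\<close> \<open>t < h\<close> by (intro exI[of _ s] exI[of _ t]) auto
qed

text \<open>The second difference of \<open>f\<close> on a small parallelogram does not change when \<open>u\<close> and \<open>v\<close> are exchanged.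
By \<open>second_difference_mean_value\<close> it is \<open>h\<^sup>2\<close> times either mixed derivative at some point of the
parallelogram, and both of these points tend to \<open>z\<close>.\<close>

lemma dir_deriv_commute:
  fixes f :: "'a::real_normed_vector \<Rightarrow> real"
  assumes "open S" and S: "smooth_on S f" and z: "z \<in> S"
  shows "dir_deriv v (dir_deriv u f) z = dir_deriv u (dir_deriv v f) z"
proof (rule ccontr)
  let ?F = "dir_deriv v (dir_deriv u f)" and ?G = "dir_deriv u (dir_deriv v f)"
  assume "?F z \<noteq> ?G z"
  define e where "e = \<bar>?F z - ?G z\<bar> / 2"
  have e: "e > 0" using \<open>?F z \<noteq> ?G z\<close> by (simp add: e_def)
  have "isCont ?F z" "isCont ?G z"
    using smooth_on_continuous[OF smooth_on_dir_deriv[OF smooth_on_dir_deriv[OF S]]]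
      continuous_on_eq_continuous_at[OF \<open>open S\<close>] z by blast+
  then obtain d1 d2 where d1: "d1 > 0" "\<And>w. dist w z < d1 \<Longrightarrow> dist (?F w) (?F z) < e"
    and d2: "d2 > 0" "\<And>w. dist w z < d2 \<Longrightarrow> dist (?G w) (?G z) < e"
    unfolding continuous_at_eps_delta using e by metis
  obtain d3 where d3: "d3 > 0" "ball z d3 \<subseteq> S"
    using \<open>open S\<close> z open_contains_ball by blast
  define d where "d = min d1 (min d2 d3)"
  have "d > 0" using d1 d2 d3 by (simp add: d_def)
  \<comment> \<open>A side length for which both parallelograms lie in the ball of radius \<open>d\<close> around \<open>z\<close>.\<close>
  define h where "h = d / (2 * (norm u + norm v + 1))"
  have nn: "0 < 2 * (norm u + norm v + 1)" by (smt (verit) norm_ge_zero)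
  have "h > 0" using \<open>d > 0\<close> nn by (simp add: h_def)
  have near: "dist (z + s *\<^sub>R a + t *\<^sub>R b) z < d"
    if "0 \<le> s" "s \<le> h" "0 \<le> t" "t \<le> h" "norm a + norm b = norm u + norm v" for s t and a b :: 'a
  proof -
    have "dist (z + s *\<^sub>R a + t *\<^sub>R b) z = norm (s *\<^sub>R a + t *\<^sub>R b)"
      by (simp add: dist_norm algebra_simps)
    also have "\<dots> \<le> s * norm a + t * norm b"
      using norm_triangle_ineq[of "s *\<^sub>R a" "t *\<^sub>R b"] that by simp
    also have "\<dots> \<le> h * norm a + h * norm b"
      using that by (intro add_mono mult_right_mono) auto
    also have "\<dots> = h * (norm u + norm v)" using that(5) by (metis distrib_left)
    also have "\<dots> < h * (2 * (norm u + norm v + 1))"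
    proof (rule mult_strict_left_mono[OF _ \<open>h > 0\<close>])
      show "norm u + norm v < 2 * (norm u + norm v + 1)"
        using nn by (simp add: algebra_simps)
    qed
    also have "\<dots> = d" using nn by (simp add: h_def)
    finally show ?thesis .
  qed
  have inS: "z + s *\<^sub>R a + t *\<^sub>R b \<in> S"
    if "0 \<le> s" "s \<le> h" "0 \<le> t" "t \<le> h" "norm a + norm b = norm u + norm v" for s t and a b :: 'a
    using near[OF that] d3 by (force simp: d_def dist_commute)
  obtain s t where st: "0 \<le> s" "s \<le> h" "0 \<le> t" "t \<le> h" and
    e1: "f (z + h *\<^sub>R u + h *\<^sub>R v) - f (z + h *\<^sub>R u) - f (z + h *\<^sub>R v) + f z =
      h * h * ?F (z + s *\<^sub>R u + t *\<^sub>R v)"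
    using second_difference_mean_value[OF S \<open>h > 0\<close>, of z u v] inS[of _ _ u v] by auto
  obtain s' t' where st': "0 \<le> s'" "s' \<le> h" "0 \<le> t'" "t' \<le> h" and
    e2: "f (z + h *\<^sub>R v + h *\<^sub>R u) - f (z + h *\<^sub>R v) - f (z + h *\<^sub>R u) + f z =
      h * h * ?G (z + s' *\<^sub>R v + t' *\<^sub>R u)"
    using second_difference_mean_value[OF S \<open>h > 0\<close>, of z v u] inS[of _ _ v u]
    by (auto simp: add.commute)
  have "f (z + h *\<^sub>R v + h *\<^sub>R u) = f (z + h *\<^sub>R u + h *\<^sub>R v)"
    by (simp add: algebra_simps)
  then have "h * h * ?F (z + s *\<^sub>R u + t *\<^sub>R v) = h * h * ?G (z + s' *\<^sub>R v + t' *\<^sub>R u)"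
    using e1 e2 by linarith
  then have eq: "?F (z + s *\<^sub>R u + t *\<^sub>R v) = ?G (z + s' *\<^sub>R v + t' *\<^sub>R u)"
    using \<open>h > 0\<close> by simp
  have "dist (?F (z + s *\<^sub>R u + t *\<^sub>R v)) (?F z) < e" "dist (?G (z + s' *\<^sub>R v + t' *\<^sub>R u)) (?G z) < e"
    using near[OF st, of u v] near[OF st', of v u] d1 d2 by (auto simp: d_def)
  then show False using eq by (simp add: e_def dist_real_def abs_if split: if_splits)
qed

text \<open>This replaces uniqueness for the linear differential equation along segments. Around a zero \<open>a\<close>,
let \<open>m\<close> be a point where \<open>\<bar>f\<bar>\<close> is maximal on a ball of radius \<open>e\<close> on which \<open>M \<le> K\<close>. The mean
value inequality gives \<open>\<bar>f m\<bar> \<le> e K \<bar>f m\<bar>\<close>, which forces \<open>f m = 0\<close> once \<open>e K < 1\<close>.\<close>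

lemma open_zero_set:
  fixes f :: "'a::euclidean_space \<Rightarrow> real"
  assumes "open S"
    and der: "\<And>z. z \<in> S \<Longrightarrow> (f has_derivative f' z) (at z)"
    and bound: "\<And>z. z \<in> S \<Longrightarrow> onorm (f' z) \<le> M z * \<bar>f z\<bar>"
    and M: "continuous_on S M"
  shows "open {z \<in> S. f z = 0}"
  unfolding open_contains_ball
proof
  fix a assume "a \<in> {z \<in> S. f z = 0}"
  then have a: "a \<in> S" "f a = 0" by auto
  obtain r where r: "r > 0" "cball a r \<subseteq> S"
    using \<open>open S\<close> a open_contains_cball by blast
  have contf: "continuous_on S f"
    using der has_derivative_continuous continuous_at_imp_continuous_on by blast
  obtain K where K: "\<And>z. z \<in> cball a r \<Longrightarrow> \<bar>M z\<bar> \<le> K"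
  proof -
    have "compact (M ` cball a r)"
      by (intro compact_continuous_image continuous_on_subset[OF M]) (use r in auto)
    then show ?thesis using that compact_imp_bounded bounded_iff by (metis image_eqI real_norm_def)
  qed
  have "K \<ge> 0" using K[of a] r by simp
  \<comment> \<open>The radius is chosen so that \<open>e K < 1\<close>.\<close>
  define e where "e = min r (1 / (2 * (K + 1)))"
  have e: "e > 0" "e \<le> r" "e * K < 1"
  proof -
    show "e > 0" "e \<le> r" using r \<open>K \<ge> 0\<close> by (auto simp: e_def)
    have "e * K \<le> 1 / (2 * (K + 1)) * K"
      using \<open>K \<ge> 0\<close> by (intro mult_right_mono) (auto simp: e_def)
    also have "\<dots> < 1" using \<open>K \<ge> 0\<close> by (simp add: field_simps)
    finally show "e * K < 1" .
  qed
  have sub: "cball a e \<subseteq> cball a r" using e by auto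
  have "\<exists>m\<in>cball a e. \<forall>y\<in>cball a e. \<bar>f y\<bar> \<le> \<bar>f m\<bar>"
    by (intro continuous_attains_sup continuous_on_rabs continuous_on_subset[OF contf])
       (use e sub r in auto)
  then obtain m where m: "m \<in> cball a e" "\<And>y. y \<in> cball a e \<Longrightarrow> \<bar>f y\<bar> \<le> \<bar>f m\<bar>" by blast
  have "norm (f m - f a) \<le> (K * \<bar>f m\<bar>) * norm (m - a)"
  proof (rule differentiable_bound[of "cball a e" f f'])
    fix x assume x: "x \<in> cball a e"
    then have xS: "x \<in> S" using sub r by auto
    show "(f has_derivative f' x) (at x within cball a e)"
      using der[OF xS] has_derivative_at_withinI by blast
    have "M x * \<bar>f x\<bar> \<le> K * \<bar>f m\<bar>"
      using K[of x] m(2)[OF x] x sub \<open>K \<ge> 0\<close> by (intro mult_mono) (auto simp: abs_le_iff)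
    then show "onorm (f' x) \<le> K * \<bar>f m\<bar>" using bound[OF xS] by linarith
  qed (use m e in auto)
  also have "\<dots> \<le> (K * \<bar>f m\<bar>) * e"
    using m(1) \<open>K \<ge> 0\<close> by (intro mult_left_mono) (auto simp: dist_norm norm_minus_commute)
  finally have "\<bar>f m\<bar> * (1 - e * K) \<le> 0" using a by (simp add: algebra_simps)
  then have "f m = 0" using e(3) by (simp add: mult_le_0_iff)
  then have "ball a e \<subseteq> {z \<in> S. f z = 0}" using m(2) sub r by force
  then show "\<exists>e>0. ball a e \<subseteq> {z \<in> S. f z = 0}" using e by blast
qed

section \<open>Sprays in local coordinates\<close>

lemma px_dir_deriv: "px k f = dir_deriv (axis k 1, 0) f"
  by (auto simp: px_def dir_deriv_def)

lemma py_dir_deriv: "py k f = dir_deriv (0, axis k 1) f"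
  by (auto simp: py_def dir_deriv_def)

lemma dir_deriv_partials:
  assumes "f differentiable (at z)"
  shows "dir_deriv u f z = (\<Sum>i\<in>UNIV. fst u $ i * px i f z) + (\<Sum>i\<in>UNIV. snd u $ i * py i f z)"
proof -
  interpret linear "\<lambda>u. dir_deriv u f z" by (rule linear_dir_deriv[OF assms])
  have "u = (\<Sum>i\<in>UNIV. fst u $ i *\<^sub>R (axis i 1, 0)) + (\<Sum>i\<in>UNIV. snd u $ i *\<^sub>R (0, axis i 1))"
    using basis_expansion[of "fst u"] basis_expansion[of "snd u"]
    by (simp add: prod_eq_iff fst_sum snd_sum scalar_mult_eq_scaleR)
  then have "dir_deriv u f z = dir_deriv ((\<Sum>i\<in>UNIV. fst u $ i *\<^sub>R (axis i 1, 0)) +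
      (\<Sum>i\<in>UNIV. snd u $ i *\<^sub>R (0, axis i 1))) f z" by simp
  then show ?thesis by (simp only: add sum scale px_dir_deriv py_dir_deriv real_scaleR_def)
qed

lemma bounded_linear_fibre_coord: "bounded_linear (\<lambda>z. snd z $ j)"
  by (rule bounded_linear_compose[OF bounded_linear_vec_nth bounded_linear_snd])

locale conical_domain =
  fixes S :: "'n::finite coords set"
  assumes open_domain: "open S"
    and fibre_nonzero: "z \<in> S \<Longrightarrow> snd z \<noteq> 0"
    and cone: "(x, y) \<in> S \<Longrightarrow> t > 0 \<Longrightarrow> (x, t *\<^sub>R y) \<in> S"
begin

lemma euler:
  fixes f :: "'n coords \<Rightarrow> real"
  assumes d: "f differentiable (at z)" and z: "z \<in> S" and hom: "pos_homogeneous_on S k f"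
  shows "(\<Sum>i\<in>UNIV. snd z $ i * py i f z) = k * f z"
proof -
  obtain x y where xy: "z = (x, y)" by (cases z)
  have 1: "((\<lambda>t. f (x, t *\<^sub>R y)) has_real_derivative dir_deriv (0, y) f z) (at 1)"
  proof -
    have c: "((\<lambda>t. (x, t *\<^sub>R y)) has_derivative (\<lambda>t. (0, t *\<^sub>R y))) (at 1)"
      by (auto intro!: derivative_eq_intros)
    have "(f has_derivative (\<lambda>u. dir_deriv u f z)) (at (x, 1 *\<^sub>R y))"
      using has_derivative_dir_deriv[OF d] xy by simp
    from has_derivative_compose[OF c this]
    have "((\<lambda>t. f (x, t *\<^sub>R y)) has_derivative (\<lambda>t. dir_deriv (t *\<^sub>R (0, y)) f z)) (at 1)"
      by simp
    then show ?thesis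
      unfolding has_field_derivative_def linear_cmul[OF linear_dir_deriv[OF d]]
      by (simp add: mult.commute[of _ "dir_deriv _ _ _"])
  qed
  have 2: "((\<lambda>t. f (x, t *\<^sub>R y)) has_real_derivative k * f z) (at 1)"
  proof (rule has_field_derivative_transform_within_open[where S = "{0<..}"])
    show "((\<lambda>t. t ^ k * f z) has_real_derivative k * f z) (at 1)"
      by (auto intro!: derivative_eq_intros)
    show "t ^ k * f z = f (x, t *\<^sub>R y)" if "t \<in> {0<..}" for t
      using hom z xy that by (auto simp: pos_homogeneous_on_def)
  qed auto
  show ?thesis
    using DERIV_unique[OF 1 2] dir_deriv_partials[OF d, of "(0, y)"] xy by simp
qed

end

text \<open>The derivative along the vector field \<open>y\<^sup>i \<partial>/\<partial>x\<^sup>i - 2 G\<^sup>i \<partial>/\<partial>y\<^sup>i\<close>. Curvature identities become short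
because this is a derivation whose commutators with constant vector fields are explicit.\<close>

definition spray_deriv :: "('n::finite coords \<Rightarrow> real ^ 'n) \<Rightarrow> ('n coords \<Rightarrow> real) \<Rightarrow> 'n coords \<Rightarrow> real" where
  "spray_deriv G f z = dir_deriv (snd z, - 2 *\<^sub>R G z) f z"

locale local_spray = conical_domain S for S :: "'n::finite coords set" +
  fixes G :: "'n coords \<Rightarrow> real ^ 'n"
  assumes smooth_coeff: "smooth_on S (\<lambda>z. G z $ r)"
    and homogeneous_coeff: "pos_homogeneous_on S 2 G"
begin

lemma spray_deriv_partials:
  assumes "f differentiable (at z)"
  shows "spray_deriv G f z =
    (\<Sum>j\<in>UNIV. snd z $ j * px j f z) - 2 * (\<Sum>r\<in>UNIV. G z $ r * py r f z)"
  by (simp add: spray_deriv_def dir_deriv_partials[OF assms] sum_distrib_left sum_negf algebra_simps)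

text \<open>The commutator of the constant field \<open>u\<close> with the spray: the two extra terms
come from differentiating the coefficients \<open>y\<close> and \<open>- 2 G\<close> of the spray.\<close>

lemma dir_deriv_spray_deriv:
  assumes f: "smooth_on S f" and z: "z \<in> S"
  shows "dir_deriv u (spray_deriv G f) z =
    (\<Sum>j\<in>UNIV. snd u $ j * px j f z) - 2 * (\<Sum>r\<in>UNIV. dir_deriv u (\<lambda>w. G w $ r) z * py r f z)
    + spray_deriv G (dir_deriv u f) z"
proof -
  note d = smooth_on_differentiable[OF _ z]
  have dp: "px j f differentiable (at z)" "py j f differentiable (at z)" for j
    unfolding px_dir_deriv py_dir_deriv by (auto intro!: d smooth_on_dir_deriv f)
  have ds: "(\<lambda>w. snd w $ j) differentiable (at z)" for j
    by (rule bounded_linear_imp_differentiable[OF bounded_linear_fibre_coord])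
  have dG: "(\<lambda>w. G w $ r) differentiable (at z)" for r by (rule d[OF smooth_coeff])
  have "dir_deriv u (spray_deriv G f) z = dir_deriv u (\<lambda>w. (\<Sum>j\<in>UNIV. snd w $ j * px j f w)
      - 2 * (\<Sum>r\<in>UNIV. G w $ r * py r f w)) z"
    by (rule dir_deriv_cong[OF open_domain z], rule spray_deriv_partials,
        rule smooth_on_differentiable[OF f])
  also have "\<dots> = (\<Sum>j\<in>UNIV. snd z $ j * dir_deriv u (px j f) z + snd u $ j * px j f z)
      - 2 * (\<Sum>r\<in>UNIV. G z $ r * dir_deriv u (py r f) z + dir_deriv u (\<lambda>w. G w $ r) z * py r f z)"
    using dp ds dG
    by (simp add: dir_deriv_diff dir_deriv_cmult dir_deriv_sum dir_deriv_mult
        dir_deriv_linear[OF bounded_linear_fibre_coord])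
  also have "\<dots> = (\<Sum>j\<in>UNIV. snd z $ j * px j (dir_deriv u f) z + snd u $ j * px j f z)
      - 2 * (\<Sum>r\<in>UNIV. G z $ r * py r (dir_deriv u f) z + dir_deriv u (\<lambda>w. G w $ r) z * py r f z)"
    unfolding px_dir_deriv py_dir_deriv
    by (simp add: dir_deriv_commute[OF open_domain f z, of u])
  also have "\<dots> = (\<Sum>j\<in>UNIV. snd u $ j * px j f z)
      - 2 * (\<Sum>r\<in>UNIV. dir_deriv u (\<lambda>w. G w $ r) z * py r f z) + spray_deriv G (dir_deriv u f) z"
    by (simp add: spray_deriv_partials[OF d[OF smooth_on_dir_deriv[OF f]]] sum.distrib algebra_simps)
  finally show ?thesis .
qed

lemma euler_coeff:
  assumes z: "z \<in> S"
  shows "(\<Sum>j\<in>UNIV. snd z $ j * nonlin_conn G r j z) = 2 * G z $ r"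
  unfolding nonlin_conn_def
proof -
  have "pos_homogeneous_on S 2 (\<lambda>z. G z $ r)"
    using homogeneous_coeff by (auto simp: pos_homogeneous_on_def)
  from euler[OF smooth_on_differentiable[OF smooth_coeff z] z this]
  show "(\<Sum>j\<in>UNIV. snd z $ j * py j (\<lambda>z. G z $ r) z) = 2 * G z $ r" by simp
qed

lemma smooth_nonlin_conn: "smooth_on S (nonlin_conn G r i)"
  unfolding nonlin_conn_def py_dir_deriv by (intro smooth_on_dir_deriv smooth_coeff)

lemma euler_nonlin_conn:
  assumes z: "z \<in> S"
  shows "(\<Sum>j\<in>UNIV. berwald_conn G r i j z * snd z $ j) = nonlin_conn G r i z"
proof -
  have ds: "(\<lambda>w. snd w $ j) differentiable (at z)" for j
    by (rule bounded_linear_imp_differentiable[OF bounded_linear_fibre_coord])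
  have dN: "nonlin_conn G r j differentiable (at z)" for j
    by (rule smooth_on_differentiable[OF smooth_nonlin_conn z])
  have "2 * nonlin_conn G r i z = py i (\<lambda>w. 2 * G w $ r) z"
    unfolding nonlin_conn_def py_dir_deriv
    by (simp add: dir_deriv_cmult smooth_on_differentiable[OF smooth_coeff z])
  also have "\<dots> = py i (\<lambda>w. \<Sum>j\<in>UNIV. snd w $ j * nonlin_conn G r j w) z"
    unfolding py_dir_deriv by (rule dir_deriv_cong[OF open_domain z]) (simp add: euler_coeff)
  also have "\<dots> = (\<Sum>j\<in>UNIV. snd z $ j * py i (nonlin_conn G r j) z)
      + (\<Sum>j\<in>UNIV. axis i 1 $ j * nonlin_conn G r j z)"
    using ds dN unfolding py_dir_deriv
    by (simp add: dir_deriv_sum dir_deriv_mult dir_deriv_linear[OF bounded_linear_fibre_coord] sum.distrib)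
  also have "(\<Sum>j\<in>UNIV. axis i 1 $ j * nonlin_conn G r j z) = nonlin_conn G r i z"
    by (simp add: axis_def if_distrib[of "\<lambda>c. c * _"] cong: if_cong)
  also have "(\<Sum>j\<in>UNIV. snd z $ j * py i (nonlin_conn G r j) z) =
      (\<Sum>j\<in>UNIV. berwald_conn G r i j z * snd z $ j)"
    unfolding nonlin_conn_def berwald_conn_def py_dir_deriv
    by (simp add: dir_deriv_commute[OF open_domain smooth_coeff z, of "(0, axis i 1)"] mult.commute)
  finally show ?thesis by simp
qed

text \<open>Since \<open>G\<close> is homogeneous of degree two, the vertical part \<open>y\<^sup>i G\<^sup>r\<^sub>i\<close> of the horizontal lift of \<open>y\<close>
is \<open>2 G\<^sup>r\<close>.\<close>

lemma delta0_eq_spray_deriv: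
  assumes "f differentiable (at z)" and z: "z \<in> S"
  shows "delta0 G f z = spray_deriv G f z"
proof -
  have "(\<Sum>i\<in>UNIV. (\<Sum>r\<in>UNIV. nonlin_conn G r i z * py r f z) * snd z $ i) =
      (\<Sum>r\<in>UNIV. (\<Sum>i\<in>UNIV. snd z $ i * nonlin_conn G r i z) * py r f z)"
    unfolding sum_distrib_right by (subst sum.swap) (simp add: algebra_simps)
  then show ?thesis
    unfolding delta0_def delta_def
    by (simp add: left_diff_distrib sum_subtractf spray_deriv_partials[OF assms(1)] euler_coeff[OF z]
        sum_distrib_left algebra_simps)
qed

lemma vdelta0_eq:
  assumes f: "smooth_on S f" and z: "z \<in> S"
  shows "vdelta0 G i f z = spray_deriv G (py i f) z - (\<Sum>r\<in>UNIV. nonlin_conn G r i z * py r f z)"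
proof -
  have "(\<Sum>j\<in>UNIV. (\<Sum>r\<in>UNIV. py r f z * berwald_conn G r i j z) * snd z $ j) =
      (\<Sum>r\<in>UNIV. (\<Sum>j\<in>UNIV. berwald_conn G r i j z * snd z $ j) * py r f z)"
    unfolding sum_distrib_right by (subst sum.swap) (simp add: algebra_simps)
  moreover have "vdelta0 G i f z = delta0 G (py i f) z
      - (\<Sum>j\<in>UNIV. (\<Sum>r\<in>UNIV. py r f z * berwald_conn G r i j z) * snd z $ j)"
    unfolding vdelta0_def vdelta_def delta0_def by (simp add: left_diff_distrib sum_subtractf)
  moreover have "py i f differentiable (at z)"
    unfolding py_dir_deriv by (rule smooth_on_differentiable[OF smooth_on_dir_deriv[OF f] z])
  ultimately show ?thesis by (simp add: euler_nonlin_conn[OF z] delta0_eq_spray_deriv[OF _ z])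
qed

text \<open>The commutator of \<open>\<partial>/\<partial>y\<^sup>i\<close> with the spray maps \<open>f\<close> to \<open>\<partial>\<^sub>i f - 2 G\<^sup>r\<^sub>i f\<^sub>.\<^sub>r\<close>. One copy of \<open>G\<^sup>r\<^sub>i f\<^sub>.\<^sub>r\<close> completes
\<open>f\<^sub>;\<^sub>i\<close>; the other is the Christoffel term of \<open>f\<^sub>.\<^sub>i\<^sub>;\<^sub>0\<close>.\<close>

lemma delta_plus_vdelta0:
  assumes f: "smooth_on S f" and z: "z \<in> S"
  shows "delta G i f z + vdelta0 G i f z = py i (delta0 G f) z"
proof -
  have "py i (delta0 G f) z = py i (spray_deriv G f) z"
    unfolding py_dir_deriv
    by (rule dir_deriv_cong[OF open_domain z], rule delta0_eq_spray_deriv[OF smooth_on_differentiable[OF f]])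
  also have "\<dots> = (\<Sum>j\<in>UNIV. axis i 1 $ j * px j f z)
      - 2 * (\<Sum>r\<in>UNIV. nonlin_conn G r i z * py r f z) + spray_deriv G (py i f) z"
    unfolding nonlin_conn_def py_dir_deriv[of i] using dir_deriv_spray_deriv[OF f z, of "(0, axis i 1)"]
    by simp
  also have "(\<Sum>j\<in>UNIV. axis i 1 $ j * px j f z) = px i f z"
    by (simp add: axis_def if_distrib[of "\<lambda>c. c * _"] cong: if_cong)
  finally show ?thesis by (simp add: vdelta0_eq[OF f z] delta_def)
qed

lemma riemann_eq:
  assumes z: "z \<in> S"
  shows "riemann G i k z = 2 * px k (\<lambda>w. G w $ i) z - spray_deriv G (nonlin_conn G i k) z
    - (\<Sum>j\<in>UNIV. nonlin_conn G i j z * nonlin_conn G j k z)"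
  unfolding spray_deriv_partials[OF smooth_on_differentiable[OF smooth_nonlin_conn z]]
  by (simp add: riemann_def nonlin_conn_def)

text \<open>The spray is applied to both sides of \<open>y\<^sup>k G\<^sup>i\<^sub>k = 2 G\<^sup>i\<close>. The result expresses \<open>y\<^sup>k\<close> times the second
derivative terms of the curvature through first derivatives, and these cancel.\<close>

lemma riemann_fibre:
  assumes z: "z \<in> S"
  shows "(\<Sum>k\<in>UNIV. riemann G i k z * snd z $ k) = 0"
proof -
  let ?N = "nonlin_conn G"
  have ds: "(\<lambda>w. snd w $ j) differentiable (at z)" for j
    by (rule bounded_linear_imp_differentiable[OF bounded_linear_fibre_coord])
  have dN: "?N r j differentiable (at z)" for r j
    by (rule smooth_on_differentiable[OF smooth_nonlin_conn z])
  have dG: "(\<lambda>w. G w $ r) differentiable (at z)" for r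
    by (rule smooth_on_differentiable[OF smooth_coeff z])
  have "2 * spray_deriv G (\<lambda>w. G w $ i) z = spray_deriv G (\<lambda>w. 2 * G w $ i) z"
    by (simp add: spray_deriv_def dir_deriv_cmult dG)
  also have "\<dots> = spray_deriv G (\<lambda>w. \<Sum>k\<in>UNIV. snd w $ k * ?N i k w) z"
    unfolding spray_deriv_def by (rule dir_deriv_cong[OF open_domain z]) (simp add: euler_coeff)
  also have "\<dots> = (\<Sum>k\<in>UNIV. snd z $ k * spray_deriv G (?N i k) z)
      - 2 * (\<Sum>k\<in>UNIV. G z $ k * ?N i k z)"
    using ds dN unfolding spray_deriv_def
    by (simp add: dir_deriv_sum dir_deriv_mult dir_deriv_linear[OF bounded_linear_fibre_coord]
        sum.distrib sum_negf sum_subtractf sum_distrib_left algebra_simps)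
  finally have 1: "(\<Sum>k\<in>UNIV. snd z $ k * spray_deriv G (?N i k) z) =
      2 * spray_deriv G (\<lambda>w. G w $ i) z + 2 * (\<Sum>k\<in>UNIV. G z $ k * ?N i k z)" by simp
  have 2: "spray_deriv G (\<lambda>w. G w $ i) z = (\<Sum>k\<in>UNIV. snd z $ k * px k (\<lambda>w. G w $ i) z)
      - 2 * (\<Sum>k\<in>UNIV. G z $ k * ?N i k z)"
    by (simp add: spray_deriv_partials[OF dG] nonlin_conn_def)
  have "(\<Sum>k\<in>UNIV. (\<Sum>j\<in>UNIV. ?N i j z * ?N j k z) * snd z $ k) =
      (\<Sum>j\<in>UNIV. ?N i j z * (\<Sum>k\<in>UNIV. snd z $ k * ?N j k z))"
    unfolding sum_distrib_right sum_distrib_left by (subst sum.swap) (simp add: algebra_simps)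
  \<comment> \<open>The quadratic connection term contracts to \<open>2 G\<^sup>j G\<^sup>i\<^sub>j\<close>.\<close>
  then have 3: "(\<Sum>k\<in>UNIV. (\<Sum>j\<in>UNIV. ?N i j z * ?N j k z) * snd z $ k) =
      2 * (\<Sum>k\<in>UNIV. G z $ k * ?N i k z)"
    by (simp add: euler_coeff[OF z] sum_distrib_left algebra_simps)
  have "(\<Sum>k\<in>UNIV. riemann G i k z * snd z $ k) =
      2 * (\<Sum>k\<in>UNIV. snd z $ k * px k (\<lambda>w. G w $ i) z)
      - (\<Sum>k\<in>UNIV. snd z $ k * spray_deriv G (?N i k) z)
      - (\<Sum>k\<in>UNIV. (\<Sum>j\<in>UNIV. ?N i j z * ?N j k z) * snd z $ k)"
    by (simp add: riemann_eq[OF z] left_diff_distrib sum_subtractf sum.distrib sum_distrib_left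
        algebra_simps)
  then show ?thesis using 1 2 3 by simp
qed

text \<open>A parallel \<open>f\<close> satisfies \<open>\<partial>\<^sub>k f = G\<^sup>r\<^sub>k f\<^sub>.\<^sub>r\<close> and is annihilated by the spray. The commutators with
\<open>\<partial>/\<partial>x\<^sup>k\<close> and \<open>\<partial>/\<partial>y\<^sup>j\<close> therefore give the spray derivatives of \<open>\<partial>\<^sub>k f\<close> and \<open>f\<^sub>.\<^sub>j\<close>. Applying
the spray to the first equation and comparing yields the claim.\<close>

lemma riemann_parallel:
  assumes f: "smooth_on S f"
    and par: "\<And>w i. w \<in> S \<Longrightarrow> delta G i f w = 0"
    and z: "z \<in> S"
  shows "(\<Sum>r\<in>UNIV. riemann G r k z * py r f z) = 0"
proof -
  let ?N = "nonlin_conn G"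
  have px: "px j f w = (\<Sum>r\<in>UNIV. ?N r j w * py r f w)" if "w \<in> S" for j w
    using par[OF that, of j] by (simp add: delta_def)
  have sf: "smooth_on S (py r f)" for r
    unfolding py_dir_deriv by (rule smooth_on_dir_deriv[OF f])
  have dN: "?N r j differentiable (at z)" for r j
    by (rule smooth_on_differentiable[OF smooth_nonlin_conn z])
  have df: "py r f differentiable (at z)" for r
    by (rule smooth_on_differentiable[OF sf z])
  have "spray_deriv G f w = 0" if "w \<in> S" for w
    using delta0_eq_spray_deriv[OF smooth_on_differentiable[OF f that] that] par[OF that]
    by (simp add: delta0_def)
  then have "dir_deriv u (spray_deriv G f) z = dir_deriv u (\<lambda>w. 0) z" for u
    by (rule dir_deriv_cong[OF open_domain z])
  then have zero: "dir_deriv u (spray_deriv G f) z = 0" for u by (simp add: dir_deriv_def)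
  \<comment> \<open>Vanishing of the spray derivative of \<open>f\<close>, differentiated along the base and along the fibre.\<close>
  have hor: "spray_deriv G (px k f) z = 2 * (\<Sum>r\<in>UNIV. px k (\<lambda>w. G w $ r) z * py r f z)"
    using zero[of "(axis k 1, 0)"] unfolding dir_deriv_spray_deriv[OF f z]
    by (simp add: px_dir_deriv[of k])
  have ver: "spray_deriv G (py j f) z = (\<Sum>r\<in>UNIV. ?N r j z * py r f z)" for j
  proof -
    have "(\<Sum>l\<in>UNIV. axis j 1 $ l * px l f z) = px j f z"
      by (simp add: axis_def if_distrib[of "\<lambda>c. c * _"] cong: if_cong)
    then show ?thesis
      using zero[of "(0, axis j 1)"] px[OF z, of j] unfolding dir_deriv_spray_deriv[OF f z]
      by (simp add: py_dir_deriv[of j] nonlin_conn_def)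
  qed
  have "spray_deriv G (px k f) z = spray_deriv G (\<lambda>w. \<Sum>r\<in>UNIV. ?N r k w * py r f w) z"
    unfolding spray_deriv_def by (rule dir_deriv_cong[OF open_domain z]) (simp add: px)
  also have "\<dots> = (\<Sum>r\<in>UNIV. ?N r k z * spray_deriv G (py r f) z)
      + (\<Sum>r\<in>UNIV. spray_deriv G (?N r k) z * py r f z)"
    using dN df unfolding spray_deriv_def
    by (simp add: dir_deriv_sum dir_deriv_mult sum.distrib)
  also have "(\<Sum>r\<in>UNIV. ?N r k z * spray_deriv G (py r f) z) =
      (\<Sum>r\<in>UNIV. (\<Sum>j\<in>UNIV. ?N r j z * ?N j k z) * py r f z)"
    unfolding ver sum_distrib_left sum_distrib_right by (subst sum.swap) (simp add: algebra_simps)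
  finally show ?thesis
    by (simp add: hor riemann_eq[OF z] left_diff_distrib sum_subtractf sum_distrib_left mult.assoc)
qed

lemma continuous_riemann: "continuous_on S (riemann G i k)"
proof -
  note sc = smooth_on_continuous[OF smooth_coeff]
    smooth_on_continuous[OF smooth_on_dir_deriv[OF smooth_coeff]]
    smooth_on_continuous[OF smooth_on_dir_deriv[OF smooth_on_dir_deriv[OF smooth_coeff]]]
  show ?thesis
    unfolding riemann_def[abs_def] px_dir_deriv py_dir_deriv
    by (intro continuous_intros sc)
qed

end

text \<open>For a spray of nonzero scalar curvature \<open>R\<^sup>i\<^sub>k = R \<delta>\<^sup>i\<^sub>k - \<tau>\<^sub>k y\<^sup>i\<close> this is the quotient \<open>\<tau>\<^sub>k / R\<close>.
Writing it through the Riemann curvature makes it visibly continuous, although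
no continuity of \<open>R\<close> and \<open>\<tau>\<^sub>k\<close> is presupposed. The formula solves \<open>R\<^sup>i\<^sub>k y\<^sup>i = R y\<^sup>k - \<tau>\<^sub>k \<bar>y\<bar>\<^sup>2\<close> for \<open>\<tau>\<^sub>k\<close>,
with \<open>(n - 1) R\<close> replaced by the Ricci curvature.\<close>

definition scalar_log_deriv :: "('n::finite coords \<Rightarrow> real ^ 'n) \<Rightarrow> 'n \<Rightarrow> 'n coords \<Rightarrow> real" where
  "scalar_log_deriv G k z =
    (ricci G z * snd z $ k - (real CARD('n) - 1) * (\<Sum>i\<in>UNIV. riemann G i k z * snd z $ i)) /
    (ricci G z * (snd z \<bullet> snd z))"

text \<open>By \<open>riemann_fibre\<close>, \<open>\<tau>\<^sub>k y\<^sup>k = R\<close>, and so the Ricci curvature is \<open>(n - 1) R\<close>. By \<open>riemann_parallel\<close>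
and Euler's relation for \<open>f\<close>, \<open>R f\<^sub>.\<^sub>k = \<tau>\<^sub>k f\<close>.\<close>

lemma (in local_spray) py_parallel_scalar_curvature:
  assumes f: "smooth_on S f" "pos_homogeneous_on S 1 f"
    and par: "\<And>w i. w \<in> S \<Longrightarrow> delta G i f w = 0"
    and z: "z \<in> S"
    and scalar: "\<And>i k. riemann G i k z = R * (if i = k then 1 else 0) - \<tau> $ k * snd z $ i"
    and ricci: "ricci G z \<noteq> 0"
  shows "py k f z = scalar_log_deriv G k z * f z"
proof -
  let ?y = "snd z" and ?m = "real CARD('n) - 1"
  have y: "?y \<noteq> 0" by (rule fibre_nonzero[OF z])
  have delta_sum: "(\<Sum>i\<in>UNIV. R * (if i = l then 1 else 0) * a i) = R * a l"
    "(\<Sum>i\<in>UNIV. R * (if l = i then 1 else 0) * a i) = R * a l" for l :: 'n and a :: "'n \<Rightarrow> real"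
    by (simp_all add: if_distrib[of "\<lambda>c. R * c"] if_distrib[of "\<lambda>c. c * _"] cong: if_cong)
  have e: "(\<Sum>i\<in>UNIV. ?y $ i * py i f z) = f z"
    using euler[OF smooth_on_differentiable[OF f(1) z] z f(2)] by simp
  have "R * ?y $ i = (\<Sum>l\<in>UNIV. \<tau> $ l * ?y $ l) * ?y $ i" for i
  proof -
    have "0 = (\<Sum>l\<in>UNIV. R * (if i = l then 1 else 0) * ?y $ l) - (\<Sum>l\<in>UNIV. \<tau> $ l * ?y $ i * ?y $ l)"
      using riemann_fibre[OF z, of i] by (simp add: scalar left_diff_distrib sum_subtractf)
    moreover have "(\<Sum>l\<in>UNIV. \<tau> $ l * ?y $ i * ?y $ l) = (\<Sum>l\<in>UNIV. \<tau> $ l * ?y $ l) * ?y $ i"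
      unfolding sum_distrib_right by (rule sum.cong) (auto simp: mult_ac)
    ultimately show ?thesis unfolding delta_sum by linarith
  qed
  moreover obtain i0 where "?y $ i0 \<noteq> 0" using y by (auto simp: vec_eq_iff)
  ultimately have R: "(\<Sum>l\<in>UNIV. \<tau> $ l * ?y $ l) = R" by (metis mult_right_cancel)
  have ric: "ricci G z = ?m * R"
    unfolding ricci_def scalar using R by (simp add: sum_subtractf algebra_simps)
  have Rf: "R * py k f z = \<tau> $ k * f z"
  proof -
    have "0 = (\<Sum>r\<in>UNIV. R * (if r = k then 1 else 0) * py r f z) - (\<Sum>r\<in>UNIV. \<tau> $ k * (?y $ r * py r f z))"
      using riemann_parallel[OF f(1) par z, of k]
      by (simp add: scalar left_diff_distrib sum_subtractf mult.assoc)
    then show ?thesis by (simp add: delta_sum e flip: sum_distrib_left)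
  qed
  have yy: "(\<Sum>i\<in>UNIV. riemann G i k z * ?y $ i) = R * ?y $ k - \<tau> $ k * (?y \<bullet> ?y)"
    using delta_sum(1)[of k "\<lambda>i. ?y $ i"]
    by (simp add: scalar left_diff_distrib sum_subtractf inner_vec_def sum_distrib_left mult.assoc)
  have "ricci G z * (?y \<bullet> ?y) * py k f z = ?m * (?y \<bullet> ?y) * (R * py k f z)"
    by (simp add: ric)
  also have "\<dots> = (ricci G z * ?y $ k - ?m * (\<Sum>i\<in>UNIV. riemann G i k z * ?y $ i)) * f z"
    unfolding Rf yy ric by (simp add: algebra_simps)
  finally show ?thesis using ricci y by (simp add: scalar_log_deriv_def field_simps)
qed

lemma (in local_spray) continuous_scalar_log_deriv:
  assumes "\<And>z. z \<in> S \<Longrightarrow> ricci G z \<noteq> 0"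
  shows "continuous_on S (scalar_log_deriv G k)"
  unfolding scalar_log_deriv_def[abs_def]
proof (intro continuous_on_divide ballI)
  have "continuous_on S (ricci G)"
    unfolding ricci_def[abs_def] by (intro continuous_intros continuous_riemann)
  then show "continuous_on S (\<lambda>z. ricci G z * snd z $ k - (real CARD('n) - 1) *
      (\<Sum>i\<in>UNIV. riemann G i k z * snd z $ i))" "continuous_on S (\<lambda>z. ricci G z * (snd z \<bullet> snd z))"
    by (intro continuous_intros continuous_riemann; assumption)+
  show "ricci G z * (snd z \<bullet> snd z) \<noteq> 0" if "z \<in> S" for z
    using assms[OF that] fibre_nonzero[OF that] by simp
qed

text \<open>\<open>L\<close> is the common logarithmic differential of all parallel functions: its
\<open>y\<close>-components are \<open>\<tau>\<^sub>k / R\<close>, and parallelism determines the \<open>x\<close>-components from these. Stating the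
equation as \<open>df = f L\<close>, without dividing by \<open>f\<close>, keeps it linear in \<open>f\<close> and valid at zeros.\<close>

lemma (in local_spray) parallel_log_derivative:
  assumes scalar: "\<And>z. z \<in> S \<Longrightarrow> \<exists>R \<tau>. \<forall>i k. riemann G i k z = R * (if i = k then 1 else 0) - \<tau> $ k * snd z $ i"
    and ricci: "\<And>z. z \<in> S \<Longrightarrow> ricci G z \<noteq> 0"
  shows "\<exists>M L. continuous_on S M \<and> (\<forall>z\<in>S. \<forall>v. \<bar>L z v\<bar> \<le> M z * norm v) \<and>
    (\<forall>f. smooth_on S f \<longrightarrow> pos_homogeneous_on S 1 f \<longrightarrow> (\<forall>z\<in>S. \<forall>i. delta G i f z = 0) \<longrightarrow>
      (\<forall>z\<in>S. (f has_derivative (\<lambda>v. f z * L z v)) (at z)))"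
proof -
  \<comment> \<open>\<open>\<alpha>\<close> and \<open>\<beta>\<close> are the fibre and base components of \<open>L\<close>.\<close>
  define \<alpha> where "\<alpha> = scalar_log_deriv G"
  define \<beta> where "\<beta> k z = (\<Sum>r\<in>UNIV. nonlin_conn G r k z * \<alpha> r z)" for k z
  define L where "L z v = (\<Sum>k\<in>UNIV. fst v $ k * \<beta> k z) + (\<Sum>k\<in>UNIV. snd v $ k * \<alpha> k z)" for z v
  define M where "M z = (\<Sum>k\<in>UNIV. \<bar>\<beta> k z\<bar>) + (\<Sum>k\<in>UNIV. \<bar>\<alpha> k z\<bar>)" for z
  have cont: "continuous_on S M"
    unfolding M_def[abs_def] \<beta>_def[abs_def] \<alpha>_def
    by (intro continuous_intros continuous_scalar_log_deriv[OF ricci] smooth_on_continuous[OF smooth_nonlin_conn])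
  have bound: "\<bar>L z v\<bar> \<le> M z * norm v" for z v
  proof -
    have c: "\<bar>fst v $ k\<bar> \<le> norm v" "\<bar>snd v $ k\<bar> \<le> norm v" for k
      using component_le_norm_cart[of "fst v" k] component_le_norm_cart[of "snd v" k]
        norm_fst_le[of "fst v" "snd v"] norm_snd_le[of "snd v" "fst v"] by auto
    have "\<bar>L z v\<bar> \<le> (\<Sum>k\<in>UNIV. \<bar>fst v $ k * \<beta> k z\<bar>) + (\<Sum>k\<in>UNIV. \<bar>snd v $ k * \<alpha> k z\<bar>)"
      unfolding L_def by (intro order_trans[OF abs_triangle_ineq] add_mono sum_abs)
    also have "\<dots> \<le> (\<Sum>k\<in>UNIV. \<bar>\<beta> k z\<bar> * norm v) + (\<Sum>k\<in>UNIV. \<bar>\<alpha> k z\<bar> * norm v)"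
      unfolding abs_mult using c
      by (intro add_mono sum_mono) (metis abs_ge_zero mult.commute mult_left_mono)+
    finally show ?thesis by (simp add: M_def distrib_right sum_distrib_right)
  qed
  have der: "(f has_derivative (\<lambda>v. f z * L z v)) (at z)"
    if f: "smooth_on S f" "pos_homogeneous_on S 1 f"
      and par: "\<And>w i. w \<in> S \<Longrightarrow> delta G i f w = 0" and z: "z \<in> S" for f z
  proof -
    obtain R \<tau> where rt: "\<And>i k. riemann G i k z = R * (if i = k then 1 else 0) - \<tau> $ k * snd z $ i"
      using scalar[OF z] by blast
    have y: "py k f z = \<alpha> k z * f z" for k
      unfolding \<alpha>_def by (rule py_parallel_scalar_curvature[OF f par z rt ricci[OF z]])
    have x: "px k f z = \<beta> k z * f z" for k
      using par[OF z, of k] by (simp add: delta_def \<beta>_def y sum_distrib_right mult.assoc)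
    have d: "f differentiable (at z)" by (rule smooth_on_differentiable[OF f(1) z])
    have "dir_deriv v f z = f z * L z v" for v
      unfolding dir_deriv_partials[OF d] L_def x y
      by (simp add: distrib_left sum_distrib_left algebra_simps)
    then show ?thesis using has_derivative_dir_deriv[OF d] by simp
  qed
  show ?thesis using cont bound der by blast
qed

lemma (in local_spray) projective_change:
  assumes P: "smooth_on S P" "pos_homogeneous_on S 1 P"
  shows "local_spray S (\<lambda>z. G z + P z *\<^sub>R snd z)"
proof unfold_locales
  fix r
  show "smooth_on S (\<lambda>z. (G z + P z *\<^sub>R snd z) $ r)"
    by (simp, intro smooth_on_add smooth_on_mult open_domain smooth_coeff P
        smooth_on_bounded_linear bounded_linear_fibre_coord)
  show "pos_homogeneous_on S 2 (\<lambda>z. G z + P z *\<^sub>R snd z)"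
    using homogeneous_coeff P(2)
    by (fastforce simp: pos_homogeneous_on_def scaleR_add_right power2_eq_square mult_ac)
qed

text \<open>Here \<open>2 Q\<^sub>;\<^sub>i = (Q\<^sub>;\<^sub>0)\<^sub>.\<^sub>i = 2 (P Q)\<^sub>.\<^sub>i\<close>, and by Euler's relation for \<open>Q\<close> the additional connection
coefficients \<open>P \<delta>\<^sup>r\<^sub>i + P\<^sub>.\<^sub>i y\<^sup>r\<close> contribute the same \<open>(P Q)\<^sub>.\<^sub>i\<close>.\<close>

lemma (in local_spray) hamel_parallel:
  assumes P: "smooth_on S P" and Q: "smooth_on S Q" "pos_homogeneous_on S 1 Q"
    and hamel: "\<And>w i. w \<in> S \<Longrightarrow> delta G i Q w = vdelta0 G i Q w"
    and factor: "\<And>w. w \<in> S \<Longrightarrow> delta0 G Q w = 2 * P w * Q w"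
    and z: "z \<in> S"
  shows "delta (\<lambda>z. G z + P z *\<^sub>R snd z) i Q z = 0"
proof -
  note d = smooth_on_differentiable[OF _ z]
  have ds: "(\<lambda>w. snd w $ j) differentiable (at z)" for j
    by (rule bounded_linear_imp_differentiable[OF bounded_linear_fibre_coord])
  have "2 * delta G i Q z = py i (delta0 G Q) z"
    using delta_plus_vdelta0[OF Q(1) z, of i] hamel[OF z, of i] by simp
  also have "\<dots> = py i (\<lambda>w. 2 * (P w * Q w)) z"
    unfolding py_dir_deriv by (rule dir_deriv_cong[OF open_domain z]) (simp add: factor)
  also have "\<dots> = 2 * (P z * py i Q z + py i P z * Q z)"
    unfolding py_dir_deriv
    using d[OF P] d[OF Q(1)] by (simp add: dir_deriv_cmult dir_deriv_mult)
  finally have D: "delta G i Q z = P z * py i Q z + py i P z * Q z" by simp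
  have N: "nonlin_conn (\<lambda>z. G z + P z *\<^sub>R snd z) r i z =
      nonlin_conn G r i z + (P z * axis i 1 $ r + py i P z * snd z $ r)" for r
    unfolding nonlin_conn_def py_dir_deriv using d[OF P] d[OF smooth_coeff] ds
    by (simp add: dir_deriv_add dir_deriv_mult dir_deriv_linear[OF bounded_linear_fibre_coord])
  have "(\<Sum>r\<in>UNIV. P z * axis i 1 $ r * py r Q z) = P z * py i Q z"
    by (simp add: axis_def if_distrib[of "\<lambda>c. c * _"] if_distrib[of "\<lambda>c. _ * c"] cong: if_cong)
  moreover have "(\<Sum>r\<in>UNIV. py i P z * snd z $ r * py r Q z) = py i P z * Q z"
    using euler[OF d[OF Q(1)] z Q(2)] by (simp add: mult.assoc flip: sum_distrib_left)
  ultimately show ?thesis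
    using D unfolding delta_def N by (simp add: distrib_right sum.distrib)
qed

section \<open>Charts of the tangent bundle\<close>

lemma chart_inv_chart: "inj_on (snd c) (fst c) \<Longrightarrow> p \<in> fst c \<Longrightarrow> chart_inv c (snd c p) = p"
  by (simp add: chart_inv_def)

lemma coord_image_Collect:
  assumes "inj_on (snd c) (fst c)"
  shows "coord_image {p \<in> W. q p} c = {z \<in> coord_image W c. q (chart_inv c z)}"
  using assms by (auto simp: coord_image_def chart_inv_def)

text \<open>Injectivity of the charts makes their images commute with intersections, so that the defining
predicate is a topology.\<close>

lemma openin_atlas_topology:
  fixes B :: "('m, 'e::euclidean_space) chart set"
  assumes inj: "\<And>c. c \<in> B \<Longrightarrow> inj_on (snd c) (fst c)"
  shows "openin (atlas_topology B) W \<longleftrightarrow> W \<subseteq> atlas_space B \<and> (\<forall>c\<in>B. open (coord_image W c))"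
proof -
  have int: "coord_image (S \<inter> T) c = coord_image S c \<inter> coord_image T c" if "c \<in> B" for S T c
    using inj[OF that] unfolding coord_image_def
    by (subst inj_on_image_Int[of "snd c" "fst c", symmetric]) (auto simp: Int_ac)
  have un: "coord_image (\<Union>\<K>) c = (\<Union>K\<in>\<K>. coord_image K c)" for \<K> and c :: "('m, 'e) chart"
    by (auto simp: coord_image_def)
  have "istopology (\<lambda>W. W \<subseteq> atlas_space B \<and> (\<forall>c\<in>B. open (coord_image W c)))"
    unfolding istopology_def by (auto simp: int un)
  then show ?thesis by (simp add: atlas_topology_def)
qed

text \<open>The two parts of \<open>D\<close> where \<open>q\<close> holds and fails are open because a set is open in the atlas topology
when its images in all charts are; connectedness leaves only one of them.\<close>

lemma connected_region_cases:
  fixes B :: "('m, 'e::euclidean_space) chart set"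
  assumes inj: "\<And>c. c \<in> B \<Longrightarrow> inj_on (snd c) (fst c)"
    and D: "openin (atlas_topology B) D" "connectedin (atlas_topology B) D"
    and op: "\<And>c. c \<in> B \<Longrightarrow> open {z \<in> coord_image D c. q (chart_inv c z)}"
    and cl: "\<And>c. c \<in> B \<Longrightarrow> open {z \<in> coord_image D c. \<not> q (chart_inv c z)}"
    and ex: "\<xi> \<in> D" "q \<xi>" and \<eta>: "\<eta> \<in> D"
  shows "q \<eta>"
proof -
  have DB: "D \<subseteq> atlas_space B" using D(1) openin_atlas_topology[OF inj] by blast
  have o: "openin (atlas_topology B) {p \<in> D. q p}" "openin (atlas_topology B) {p \<in> D. \<not> q p}"
    using DB op cl by (auto simp: openin_atlas_topology[OF inj] coord_image_Collect inj)
  have "\<not> (D \<subseteq> E \<union> F \<and> E \<inter> F \<inter> D = {} \<and> E \<inter> D \<noteq> {} \<and> F \<inter> D \<noteq> {})"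
    if "openin (atlas_topology B) E" "openin (atlas_topology B) F" for E F
    using D(2) that unfolding connectedin by blast
  from this[OF o] have "{p \<in> D. \<not> q p} \<inter> D = {}" using ex by blast
  then show ?thesis using \<eta> by blast
qed

lemma lift_chart_simps:
  "\<xi> \<in> fst (lift_chart A c) \<longleftrightarrow> fst \<xi> \<in> fst c \<and> snd \<xi> \<in> tangent_space A (fst \<xi>)"
  "snd (lift_chart A c) \<xi> = (snd c (fst \<xi>), snd \<xi> c)"
  by (cases \<xi>; simp add: lift_chart_def)+

lemma tangent_space_transition:
  assumes "v \<in> tangent_space A p" "c \<in> A" "d \<in> A" "p \<in> fst c" "p \<in> fst d"
  shows "v d = dir_deriv (v c) (snd d \<circ> chart_inv c) (snd c p)"
  using assms unfolding tangent_space_def dir_deriv_def by blast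

text \<open>The components of a tangent vector in all charts follow from those in one chart. This is why the
lifted charts are injective.\<close>

lemma tangent_space_determined:
  assumes "v \<in> tangent_space A p" "w \<in> tangent_space A p" "c \<in> A" "p \<in> fst c" "v c = w c"
  shows "v = w"
proof
  fix d
  show "v d = w d"
  proof (cases "d \<in> A \<and> p \<in> fst d")
    case True
    then have "u d = dir_deriv (u c) (snd d \<circ> chart_inv c) (snd c p)"
      if "u \<in> tangent_space A p" for u
      using that assms(3,4) by (intro tangent_space_transition) auto
    from this[OF assms(1)] this[OF assms(2)] show ?thesis by (simp only: assms(5))
  next
    case False
    then have "u d = 0" if "u \<in> tangent_space A p" for u
      using that unfolding tangent_space_def by blast
    from this[OF assms(1)] this[OF assms(2)] show ?thesis by simp
  qed
qed

lemma zero_tangent_vector: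
  assumes A: "smooth_manifold A" and c: "c \<in> A" "p \<in> fst c"
  shows "(\<lambda>_. 0) \<in> tangent_space A p"
  unfolding tangent_space_def
proof (safe)
  fix c d assume cd: "c \<in> A" "d \<in> A" and p: "p \<in> fst c" "p \<in> fst d"
  have "(snd d \<circ> chart_inv c) differentiable (at (snd c p))"
    using A cd p unfolding smooth_manifold_def
    by (intro smooth_on_differentiable[of "coord_image (fst d) c"]) (auto simp: coord_image_def)
  from linear_0[OF linear_frechet_derivative[OF this]]
  show "0 = frechet_derivative (snd d \<circ> chart_inv c) (at (snd c p)) 0" by (rule sym)
qed

lemma inj_on_lift_chart:
  assumes A: "smooth_manifold A" and c: "c \<in> A"
  shows "inj_on (snd (lift_chart A c)) (fst (lift_chart A c))"
proof (rule inj_onI)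
  fix \<xi> \<eta> assume h: "\<xi> \<in> fst (lift_chart A c)" "\<eta> \<in> fst (lift_chart A c)"
    "snd (lift_chart A c) \<xi> = snd (lift_chart A c) \<eta>"
  then have "fst \<xi> = fst \<eta>"
    using A c by (auto simp: lift_chart_simps smooth_manifold_def inj_on_def)
  moreover from this have "snd \<xi> = snd \<eta>"
    using h c tangent_space_determined[of "snd \<xi>" A "fst \<xi>" "snd \<eta>" c]
    by (auto simp: lift_chart_simps)
  ultimately show "\<xi> = \<eta>" by (simp add: prod_eq_iff)
qed

section \<open>Propagation over a conical region\<close>

locale conical_manifold =
  fixes A :: "('m, real ^ 'n) chart set" and D :: "('m, real ^ 'n) tangent set"
  assumes manifold: "smooth_manifold A" and conical: "conical_region A D"
begin

lemma inj_tangent_atlas: "c \<in> tangent_atlas A \<Longrightarrow> inj_on (snd c) (fst c)"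
  unfolding tangent_atlas_def by (erule imageE) (simp add: inj_on_lift_chart[OF manifold])

lemma region_charts:
  shows "D \<subseteq> atlas_space (tangent_atlas A)"
    and "c \<in> tangent_atlas A \<Longrightarrow> open (coord_image D c)"
proof -
  have "openin (atlas_topology (tangent_atlas A)) D"
    using conical by (simp add: conical_region_def)
  then have "D \<subseteq> atlas_space (tangent_atlas A) \<and> (\<forall>c\<in>tangent_atlas A. open (coord_image D c))"
    by (subst (asm) openin_atlas_topology[OF inj_tangent_atlas])
  then show "D \<subseteq> atlas_space (tangent_atlas A)"
    and "c \<in> tangent_atlas A \<Longrightarrow> open (coord_image D c)" by blast+
qed

lemma open_coord_dom: "c \<in> A \<Longrightarrow> open (coord_dom A D c)"
  unfolding coord_dom_def by (rule region_charts) (simp add: tangent_atlas_def)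

lemma region_cover: "\<xi> \<in> D \<Longrightarrow> \<exists>c\<in>A. \<xi> \<in> fst (lift_chart A c)"
  using region_charts(1) unfolding atlas_space_def tangent_atlas_def by blast

lemma coord_domI: "\<xi> \<in> D \<Longrightarrow> \<xi> \<in> fst (lift_chart A c) \<Longrightarrow> snd (lift_chart A c) \<xi> \<in> coord_dom A D c"
  by (auto simp: coord_dom_def coord_image_def)

lemma coord_domE:
  assumes "c \<in> A" "z \<in> coord_dom A D c"
  obtains \<xi> where "\<xi> \<in> D" "\<xi> \<in> fst (lift_chart A c)" "z = snd (lift_chart A c) \<xi>"
    "chart_inv (lift_chart A c) z = \<xi>"
proof -
  from assms(2) obtain \<xi> where \<xi>: "\<xi> \<in> D" "\<xi> \<in> fst (lift_chart A c)" "z = snd (lift_chart A c) \<xi>"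
    unfolding coord_dom_def coord_image_def by blast
  have "chart_inv (lift_chart A c) z = \<xi>"
    unfolding \<xi>(3) by (rule chart_inv_chart[OF inj_on_lift_chart[OF manifold assms(1)] \<xi>(2)])
  then show ?thesis by (rule that[OF \<xi>])
qed

lemma local_rep_chart:
  "c \<in> A \<Longrightarrow> \<xi> \<in> fst (lift_chart A c) \<Longrightarrow> local_rep A f c (snd (lift_chart A c) \<xi>) = f \<xi>"
  unfolding local_rep_def comp_def
  by (subst chart_inv_chart[OF inj_on_lift_chart[OF manifold]]) simp_all

lemma conical_domain_coord_dom:
  assumes c: "c \<in> A"
  shows "conical_domain (coord_dom A D c)"
proof
  show "open (coord_dom A D c)" by (rule open_coord_dom[OF c])
next
  fix z assume "z \<in> coord_dom A D c"
  with c obtain \<xi> where \<xi>: "\<xi> \<in> D" "\<xi> \<in> fst (lift_chart A c)" "z = snd (lift_chart A c) \<xi>"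
    by (rule coord_domE)
  have "snd \<xi> \<noteq> (\<lambda>_. 0)" using conical \<xi>(1) by (auto simp: conical_region_def)
  then show "snd z \<noteq> 0"
    using tangent_space_determined[OF _ zero_tangent_vector[OF manifold c] c] \<xi>
    by (auto simp: lift_chart_simps)
next
  fix x y and t :: real assume z: "(x, y) \<in> coord_dom A D c" and t: "t > 0"
  from c z obtain \<xi> where \<xi>: "\<xi> \<in> D" "\<xi> \<in> fst (lift_chart A c)" "(x, y) = snd (lift_chart A c) \<xi>"
    by (rule coord_domE)
  define \<eta> where "\<eta> = (fst \<xi>, \<lambda>c. t *\<^sub>R snd \<xi> c)"
  have "\<eta> \<in> D" using conical \<xi>(1) t by (auto simp: conical_region_def \<eta>_def)
  moreover from region_cover[OF this] \<xi>(2) have "\<eta> \<in> fst (lift_chart A c)"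
    by (auto simp: lift_chart_simps \<eta>_def)
  ultimately have "snd (lift_chart A c) \<eta> \<in> coord_dom A D c" by (rule coord_domI)
  then show "(x, t *\<^sub>R y) \<in> coord_dom A D c"
    using \<xi>(3) by (simp add: lift_chart_simps \<eta>_def)
qed

lemma local_spray_coord_dom:
  assumes X: "spray A D X" and c: "c \<in> A"
  shows "local_spray (coord_dom A D c) (spray_coeff A X c)"
proof -
  interpret conical_domain "coord_dom A D c" by (rule conical_domain_coord_dom[OF c])
  show ?thesis
  proof
    show "pos_homogeneous_on (coord_dom A D c) 2 (spray_coeff A X c)"
      using X c by (simp add: spray_def)
    fix r
    have "lift_chart A c \<in> tangent_atlas A" using c by (simp add: tangent_atlas_def)
    then have s: "smooth_on (coord_dom A D c) (\<lambda>z. X (chart_inv (lift_chart A c) z) (lift_chart A c))"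
      using X by (auto simp: spray_def smooth_vector_field_def coord_dom_def)
    have "bounded_linear (\<lambda>w :: 'n coords. (- (1/2) *\<^sub>R snd w) $ r)"
      by (intro bounded_linear_compose[OF bounded_linear_vec_nth]
          bounded_linear_compose[OF bounded_linear_scaleR_right] bounded_linear_snd)
    from smooth_on_linear_image[OF open_domain this s]
    show "smooth_on (coord_dom A D c) (\<lambda>z. spray_coeff A X c z $ r)"
      by (simp add: spray_coeff_def local_rep_def)
  qed
qed

lemma hamel_log_derivative:
  assumes X: "spray A D X" and P: "homogeneous_one A D P"
    and curv: "nonzero_scalar_curvature A D (\<lambda>c z. spray_coeff A X c z + local_rep A P c z *\<^sub>R snd z)"
    and c: "c \<in> A"
  shows "\<exists>M L. continuous_on (coord_dom A D c) M \<and>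
    (\<forall>z\<in>coord_dom A D c. \<forall>v. \<bar>L z v\<bar> \<le> M z * norm v) \<and>
    (\<forall>Q. hamel_system A D X P Q \<longrightarrow> (\<forall>z\<in>coord_dom A D c.
      (local_rep A Q c has_derivative (\<lambda>v. local_rep A Q c z * L z v)) (at z)))"
proof -
  let ?G = "spray_coeff A X c" and ?P = "local_rep A P c" and ?S = "coord_dom A D c"
  let ?H = "\<lambda>z. ?G z + ?P z *\<^sub>R snd z"
  interpret G: local_spray ?S ?G by (rule local_spray_coord_dom[OF X c])
  have P: "smooth_on ?S ?P" "pos_homogeneous_on ?S 1 ?P"
    using P c by (auto simp: homogeneous_one_def)
  interpret H: local_spray ?S ?H by (rule G.projective_change[OF P])
  have scalar: "\<exists>R \<tau>. \<forall>i k. riemann ?H i k z = R * (if i = k then 1 else 0) - \<tau> $ k * snd z $ i"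
    and ricci: "ricci ?H z \<noteq> 0" if "z \<in> ?S" for z
    using curv c that unfolding nonzero_scalar_curvature_def scalar_curvature_def by blast+
  have par: "smooth_on ?S (local_rep A Q c) \<and> pos_homogeneous_on ?S 1 (local_rep A Q c) \<and>
      (\<forall>z\<in>?S. \<forall>i. delta ?H i (local_rep A Q c) z = 0)" if Q: "hamel_system A D X P Q" for Q
  proof -
    have Qs: "smooth_on ?S (local_rep A Q c)" "pos_homogeneous_on ?S 1 (local_rep A Q c)"
      and ham: "\<And>w i. w \<in> ?S \<Longrightarrow> delta ?G i (local_rep A Q c) w = vdelta0 ?G i (local_rep A Q c) w"
      and fac: "\<And>w. w \<in> ?S \<Longrightarrow> delta0 ?G (local_rep A Q c) w = 2 * ?P w * local_rep A Q c w"
      using Q c by (auto simp: hamel_system_def hamel_function_def homogeneous_one_def)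
    show ?thesis using Qs G.hamel_parallel[OF P(1) Qs ham fac] by blast
  qed
  have "\<exists>M L. continuous_on ?S M \<and> (\<forall>z\<in>?S. \<forall>v. \<bar>L z v\<bar> \<le> M z * norm v) \<and>
      (\<forall>f. smooth_on ?S f \<longrightarrow> pos_homogeneous_on ?S 1 f \<longrightarrow> (\<forall>z\<in>?S. \<forall>i. delta ?H i f z = 0) \<longrightarrow>
        (\<forall>z\<in>?S. (f has_derivative (\<lambda>v. f z * L z v)) (at z)))"
    by (rule H.parallel_log_derivative[OF scalar ricci])
  then obtain M L where "continuous_on ?S M" "\<forall>z\<in>?S. \<forall>v. \<bar>L z v\<bar> \<le> M z * norm v"
    and der: "\<forall>f. smooth_on ?S f \<longrightarrow> pos_homogeneous_on ?S 1 f \<longrightarrow>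
      (\<forall>z\<in>?S. \<forall>i. delta ?H i f z = 0) \<longrightarrow>
      (\<forall>z\<in>?S. (f has_derivative (\<lambda>v. f z * L z v)) (at z))" by (elim exE conjE)
  moreover have "(local_rep A Q c has_derivative (\<lambda>v. local_rep A Q c z * L z v)) (at z)"
    if "hamel_system A D X P Q" "z \<in> ?S" for Q z
    using der par[OF that(1)] that(2) by simp
  ultimately show ?thesis by blast
qed

text \<open>The difference \<open>W = Q - k Q'\<close> satisfies the linear equation \<open>dW = W L\<close>, so the set where it vanishes is
open, and it is closed by continuity.\<close>

lemma hamel_ratio_propagates:
  assumes X: "spray A D X" and P: "homogeneous_one A D P"
    and curv: "nonzero_scalar_curvature A D (\<lambda>c z. spray_coeff A X c z + local_rep A P c z *\<^sub>R snd z)"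
    and Q: "hamel_system A D X P Q" "hamel_system A D X P Q'"
    and \<xi>: "\<xi> \<in> D" "Q \<xi> = k * Q' \<xi>" and \<eta>: "\<eta> \<in> D"
  shows "Q \<eta> = k * Q' \<eta>"
proof (rule connected_region_cases[where B = "tangent_atlas A" and D = D and \<xi> = \<xi> and \<eta> = \<eta>
      and q = "\<lambda>\<xi>. Q \<xi> = k * Q' \<xi>"])
  show "openin (atlas_topology (tangent_atlas A)) D" "connectedin (atlas_topology (tangent_atlas A)) D"
    using conical by (auto simp: conical_region_def)
next
  fix c' assume "c' \<in> tangent_atlas A"
  then obtain c where c: "c \<in> A" "c' = lift_chart A c" by (auto simp: tangent_atlas_def)
  let ?S = "coord_dom A D c"
  have S: "coord_image D c' = ?S" by (simp add: c coord_dom_def)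
  define W where "W z = local_rep A Q c z - k * local_rep A Q' c z" for z
  have W: "Q (chart_inv c' z) = k * Q' (chart_inv c' z) \<longleftrightarrow> W z = 0" for z
    by (simp add: W_def local_rep_def c)
  obtain M L where M: "continuous_on ?S M"
    and bound: "\<forall>z\<in>?S. \<forall>v. \<bar>L z v\<bar> \<le> M z * norm v"
    and der: "\<forall>Q. hamel_system A D X P Q \<longrightarrow> (\<forall>z\<in>?S.
      (local_rep A Q c has_derivative (\<lambda>v. local_rep A Q c z * L z v)) (at z))"
    using hamel_log_derivative[OF X P curv c(1)] by (elim exE conjE)
  have dW: "(W has_derivative (\<lambda>v. W z * L z v)) (at z)" if "z \<in> ?S" for z
  proof -
    have "(W has_derivative (\<lambda>v. local_rep A Q c z * L z v - k * (local_rep A Q' c z * L z v))) (at z)"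
      unfolding W_def[abs_def]
      by (intro has_derivative_diff has_derivative_mult_right der[rule_format, OF _ that] Q)
    then show ?thesis by (simp add: W_def algebra_simps)
  qed
  show "open {z \<in> coord_image D c'. Q (chart_inv c' z) = k * Q' (chart_inv c' z)}"
    unfolding W S
  proof (rule open_zero_set[OF open_coord_dom[OF c(1)] dW _ M])
    fix z assume z: "z \<in> ?S"
    show "onorm (\<lambda>v. W z * L z v) \<le> M z * \<bar>W z\<bar>"
      using mult_left_mono[OF bound[rule_format, OF z], of "\<bar>W z\<bar>"]
      by (intro onorm_le) (simp add: abs_mult mult_ac)
  qed
  have "continuous_on ?S W"
    using dW has_derivative_continuous continuous_at_imp_continuous_on by blast
  then have "open (?S \<inter> W -` (- {0}))"
    by (rule continuous_open_preimage[OF _ open_coord_dom[OF c(1)]]) auto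
  then show "open {z \<in> coord_image D c'. \<not> (Q (chart_inv c' z) = k * Q' (chart_inv c' z))}"
    unfolding W S by (simp add: Int_def vimage_def)
qed (use assms inj_tangent_atlas in auto)

end

section \<open>Coordinate invariance of the spray derivative\<close>

lemma open_coord_overlap:
  assumes "smooth_manifold A" "c \<in> A" "d \<in> A"
  shows "open (coord_image (fst d) c)" "smooth_on (coord_image (fst d) c) (snd d \<circ> chart_inv c)"
  using assms by (auto simp: smooth_manifold_def)

context conical_manifold
begin

lemma base_chart_inv: "c \<in> A \<Longrightarrow> p \<in> fst c \<Longrightarrow> chart_inv c (snd c p) = p"
  using manifold by (intro chart_inv_chart) (auto simp: smooth_manifold_def)

text \<open>The coordinate change of the tangent bundle is \<open>(x, y) \<mapsto> (\<psi> x, d\<psi>\<^sub>x y)\<close>. Expanding \<open>y\<close> in a basis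
reduces its differentiability to that of the directional derivatives of \<open>\<psi>\<close>.\<close>

lemma lifted_transition:
  assumes c: "c \<in> A" and d: "d \<in> A"
  defines "U \<equiv> coord_dom A D c \<inter> coord_image (fst d) c \<times> UNIV"
    and "\<psi> \<equiv> snd d \<circ> chart_inv c" and "\<phi> \<equiv> snd (lift_chart A d) \<circ> chart_inv (lift_chart A c)"
  shows "open U"
    and "\<And>z. z \<in> U \<Longrightarrow> chart_inv (lift_chart A c) z \<in> D \<inter> fst (lift_chart A d)"
    and "\<And>z. z \<in> U \<Longrightarrow> \<phi> z = (\<psi> (fst z), \<Sum>b\<in>Basis. (snd z \<bullet> b) *\<^sub>R dir_deriv b \<psi> (fst z))"
    and "\<And>z. z \<in> U \<Longrightarrow> \<phi> differentiable (at z)"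
proof -
  note \<psi> = open_coord_overlap[OF manifold c d, folded \<psi>_def]
  show U: "open U"
    unfolding U_def by (intro open_Int open_coord_dom c open_Times \<psi>) auto
  have mem: "chart_inv (lift_chart A c) z \<in> D \<inter> fst (lift_chart A d) \<and>
      \<phi> z = (\<psi> (fst z), \<Sum>b\<in>Basis. (snd z \<bullet> b) *\<^sub>R dir_deriv b \<psi> (fst z))" if z: "z \<in> U" for z
  proof -
    have "z \<in> coord_dom A D c" using z by (simp add: U_def)
    with c obtain \<xi> where \<xi>: "\<xi> \<in> D" "\<xi> \<in> fst (lift_chart A c)" "z = snd (lift_chart A c) \<xi>"
      "chart_inv (lift_chart A c) z = \<xi>" by (rule coord_domE)
    have f: "fst \<xi> \<in> fst c" "snd \<xi> \<in> tangent_space A (fst \<xi>)" "fst z = snd c (fst \<xi>)" "snd z = snd \<xi> c"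
      using \<xi> by (auto simp: lift_chart_simps)
    have "fst z \<in> coord_image (fst d) c" using z by (auto simp: U_def)
    then obtain q where q: "q \<in> fst d" "q \<in> fst c" "fst z = snd c q" by (auto simp: coord_image_def)
    have "fst \<xi> = q" using base_chart_inv[OF c q(2)] base_chart_inv[OF c f(1)] q f by simp
    then have pd: "fst \<xi> \<in> fst d" using q by simp
    have lin: "linear (\<lambda>b. dir_deriv b \<psi> (fst z))"
      by (rule linear_dir_deriv[OF smooth_on_differentiable[OF \<psi>(2) \<open>fst z \<in> coord_image (fst d) c\<close>]])
    have "snd \<xi> d = dir_deriv (snd \<xi> c) \<psi> (fst z)"
      unfolding f(3) \<psi>_def by (rule tangent_space_transition[OF f(2) c d f(1) pd])
    also have "\<dots> = dir_deriv (\<Sum>b\<in>Basis. (snd z \<bullet> b) *\<^sub>R b) \<psi> (fst z)"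
      by (simp only: f euclidean_representation)
    also have "\<dots> = (\<Sum>b\<in>Basis. (snd z \<bullet> b) *\<^sub>R dir_deriv b \<psi> (fst z))"
      by (simp only: linear_sum[OF lin] linear_cmul[OF lin])
    finally have "snd \<xi> d = \<dots>" .
    moreover have "snd d (fst \<xi>) = \<psi> (fst z)"
      using base_chart_inv[OF c f(1)] f(3) by (simp add: \<psi>_def)
    ultimately show ?thesis
      using \<xi> pd f(2) by (auto simp: \<phi>_def lift_chart_simps)
  qed
  then show "\<And>z. z \<in> U \<Longrightarrow> chart_inv (lift_chart A c) z \<in> D \<inter> fst (lift_chart A d)"
    and rep: "\<And>z. z \<in> U \<Longrightarrow> \<phi> z = (\<psi> (fst z), \<Sum>b\<in>Basis. (snd z \<bullet> b) *\<^sub>R dir_deriv b \<psi> (fst z))"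
    by blast+
  fix z assume z: "z \<in> U"
  then have fz: "fst z \<in> coord_image (fst d) c" by (auto simp: U_def)
  have fstd: "fst differentiable (at z)"
    by (rule bounded_linear_imp_differentiable[OF bounded_linear_fst])
  have comp: "(\<lambda>w. g (fst w)) differentiable (at z)"
    if "g differentiable (at (fst z))" for g :: "real ^ 'n \<Rightarrow> real ^ 'n"
    using differentiable_chain_at[OF fstd that] by (simp add: comp_def)
  have inn: "(\<lambda>w. snd w \<bullet> b) differentiable (at z)" for b :: "real ^ 'n"
    by (rule bounded_linear_imp_differentiable)
       (rule bounded_linear_compose[OF bounded_linear_inner_left bounded_linear_snd])
  have "(\<lambda>w. (\<psi> (fst w), \<Sum>b\<in>Basis. (snd w \<bullet> b) *\<^sub>R dir_deriv b \<psi> (fst w))) differentiable (at z)"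
    by (intro differentiable_Pair differentiable_sum differentiable_scaleR ballI inn comp finite_Basis
        smooth_on_differentiable[OF \<psi>(2) fz] smooth_on_differentiable[OF smooth_on_dir_deriv[OF \<psi>(2)] fz])
  then obtain g where "((\<lambda>w. (\<psi> (fst w), \<Sum>b\<in>Basis. (snd w \<bullet> b) *\<^sub>R dir_deriv b \<psi> (fst w)))
      has_derivative g) (at z)"
    unfolding differentiable_def by blast
  then have "(\<phi> has_derivative g) (at z)"
    by (rule has_derivative_transform_within_open[OF _ U z]) (simp only: rep)
  then show "\<phi> differentiable (at z)" unfolding differentiable_def by blast
qed

text \<open>The chain rule: the local expressions of \<open>Q\<close> are related by the coordinate change of the
tangent bundle, and the components of \<open>X\<close> by its differential.\<close>

lemma dir_deriv_chart_independent:
  assumes X: "spray A D X" and Q: "homogeneous_one A D Q"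
    and c: "c \<in> A" and d: "d \<in> A" and \<xi>: "\<xi> \<in> D" "\<xi> \<in> fst (lift_chart A c)" "\<xi> \<in> fst (lift_chart A d)"
  shows "dir_deriv (X \<xi> (lift_chart A c)) (local_rep A Q c) (snd (lift_chart A c) \<xi>) =
    dir_deriv (X \<xi> (lift_chart A d)) (local_rep A Q d) (snd (lift_chart A d) \<xi>)"
proof -
  let ?U = "coord_dom A D c \<inter> coord_image (fst d) c \<times> UNIV"
  let ?\<phi> = "snd (lift_chart A d) \<circ> chart_inv (lift_chart A c)"
  let ?z = "snd (lift_chart A c) \<xi>"
  note T = lifted_transition[OF c d]
  have z: "?z \<in> ?U"
    using \<xi> coord_domI[OF \<xi>(1,2)] by (auto simp: lift_chart_simps coord_image_def)
  have \<phi>z: "?\<phi> ?z = snd (lift_chart A d) \<xi>"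
    using chart_inv_chart[OF inj_on_lift_chart[OF manifold c] \<xi>(2)] by simp
  have Xd: "X \<xi> (lift_chart A d) = dir_deriv (X \<xi> (lift_chart A c)) ?\<phi> ?z"
  proof (rule tangent_space_transition)
    show "X \<xi> \<in> tangent_space (tangent_atlas A) \<xi>"
      using X \<xi>(1) by (simp add: spray_def smooth_vector_field_def)
    show "lift_chart A c \<in> tangent_atlas A" "lift_chart A d \<in> tangent_atlas A"
      using c d by (simp_all add: tangent_atlas_def)
  qed (fact \<xi>(2) \<xi>(3))+
  have dQ: "local_rep A Q d differentiable (at (?\<phi> ?z))"
    unfolding \<phi>z using Q d coord_domI[OF \<xi>(1,3)]
    by (auto simp: homogeneous_one_def intro: smooth_on_differentiable)
  have "dir_deriv (X \<xi> (lift_chart A c)) (local_rep A Q c) ?z =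
      dir_deriv (X \<xi> (lift_chart A c)) (local_rep A Q d \<circ> ?\<phi>) ?z"
  proof (rule dir_deriv_cong[OF T(1) z])
    fix w assume "w \<in> ?U"
    from T(2)[OF this] local_rep_chart[OF d, of "chart_inv (lift_chart A c) w" Q]
    show "local_rep A Q c w = (local_rep A Q d \<circ> ?\<phi>) w" by (simp add: local_rep_def)
  qed
  also have "\<dots> = dir_deriv (dir_deriv (X \<xi> (lift_chart A c)) ?\<phi> ?z) (local_rep A Q d) (?\<phi> ?z)"
    unfolding dir_deriv_def frechet_derivative_compose[OF T(4)[OF z] dQ] by simp
  finally show ?thesis unfolding Xd[symmetric] \<phi>z .
qed

lemma delta0_spray:
  assumes X: "spray A D X" and Q: "homogeneous_one A D Q"
    and c: "c \<in> A" and \<xi>: "\<xi> \<in> D" "\<xi> \<in> fst (lift_chart A c)"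
  shows "delta0 (spray_coeff A X c) (local_rep A Q c) (snd (lift_chart A c) \<xi>) =
    dir_deriv (X \<xi> (lift_chart A c)) (local_rep A Q c) (snd (lift_chart A c) \<xi>)"
proof -
  let ?z = "snd (lift_chart A c) \<xi>"
  interpret local_spray "coord_dom A D c" "spray_coeff A X c" by (rule local_spray_coord_dom[OF X c])
  have z: "?z \<in> coord_dom A D c" by (rule coord_domI[OF \<xi>])
  have "fst (local_rep A X c ?z (lift_chart A c)) = snd ?z" using X c z by (auto simp: spray_def)
  then have "(snd ?z, - 2 *\<^sub>R spray_coeff A X c ?z) = X \<xi> (lift_chart A c)"
    by (simp add: spray_coeff_def local_rep_chart[OF c \<xi>(2)] prod_eq_iff)
  moreover have "local_rep A Q c differentiable (at ?z)"
    using Q c z by (auto simp: homogeneous_one_def intro: smooth_on_differentiable)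
  ultimately show ?thesis
    using delta0_eq_spray_deriv[OF _ z] by (simp add: spray_deriv_def)
qed

lemma delta0_quotient_fun_class:
  assumes X: "spray A D X" and Q: "homogeneous_one A D Q" and R: "R \<in> fun_class D Q"
    and c: "c \<in> A" and z: "z \<in> coord_dom A D c"
  shows "delta0 (spray_coeff A X c) (local_rep A R c) z / (2 * local_rep A R c z) =
    delta0 (spray_coeff A X c) (local_rep A Q c) z / (2 * local_rep A Q c z)"
proof -
  obtain k where k: "k \<noteq> 0" "R = restrict (\<lambda>p. k * Q p) D" using R by (auto simp: fun_class_def)
  have eq: "local_rep A R c w = k * local_rep A Q c w" if "w \<in> coord_dom A D c" for w
  proof -
    from c that obtain \<xi> where "\<xi> \<in> D" "\<xi> \<in> fst (lift_chart A c)" "w = snd (lift_chart A c) \<xi>"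
      by (rule coord_domE)
    then show ?thesis by (simp add: local_rep_chart[OF c] k(2))
  qed
  have d: "local_rep A Q c differentiable (at z)"
    using Q c z by (auto simp: homogeneous_one_def intro: smooth_on_differentiable)
  have D: "dir_deriv u (local_rep A R c) z = k * dir_deriv u (local_rep A Q c) z" for u
    using dir_deriv_cong[OF open_coord_dom[OF c] z eq] dir_deriv_cmult[OF d] by simp
  have "delta0 (spray_coeff A X c) (local_rep A R c) z =
      k * delta0 (spray_coeff A X c) (local_rep A Q c) z"
    unfolding delta0_def delta_def px_dir_deriv py_dir_deriv D
    by (simp add: sum_distrib_left algebra_simps)
  then show ?thesis using k(1) by (simp add: eq[OF z])
qed

text \<open>The definite description in \<open>H1\<close> denotes something: all representatives of a class give the
same quotient, and by \<open>dir_deriv_chart_independent\<close> so do all charts. Hence the value computed in an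
arbitrarily chosen chart is a witness.\<close>

lemma H1_fun_class:
  assumes X: "spray A D X" and Q: "homogeneous_one A D Q"
  shows "H1 A D X (fun_class D Q) \<in> extensional D"
    and "\<And>c z. c \<in> A \<Longrightarrow> z \<in> coord_dom A D c \<Longrightarrow>
      local_rep A (H1 A D X (fun_class D Q)) c z =
        delta0 (spray_coeff A X c) (local_rep A Q c) z / (2 * local_rep A Q c z)"
proof -
  let ?g = "\<lambda>R c z. delta0 (spray_coeff A X c) (local_rep A R c) z / (2 * local_rep A R c z)"
  define q where "q F \<longleftrightarrow> F \<in> extensional D \<and> (\<forall>R\<in>fun_class D Q. \<forall>c\<in>A. \<forall>z\<in>coord_dom A D c.
    local_rep A F c z = ?g R c z)" for F
  have "restrict (\<lambda>p. 1 * Q p) D \<in> fun_class D Q"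
    unfolding fun_class_def mem_Collect_eq by (rule exI[of _ 1]) simp
  moreover have "?g R c z = ?g Q c z" if "R \<in> fun_class D Q" "c \<in> A" "z \<in> coord_dom A D c" for R c z
    by (rule delta0_quotient_fun_class[OF X Q that])
  ultimately have q: "q F \<longleftrightarrow> F \<in> extensional D \<and>
      (\<forall>c\<in>A. \<forall>z\<in>coord_dom A D c. local_rep A F c z = ?g Q c z)" for F
    unfolding q_def by (metis (no_types, lifting))
  define ch where "ch \<xi> = (SOME c. c \<in> A \<and> \<xi> \<in> fst (lift_chart A c))" for \<xi>
  have ch: "ch \<xi> \<in> A" "\<xi> \<in> fst (lift_chart A (ch \<xi>))" if "\<xi> \<in> D" for \<xi>
    using someI_ex[OF region_cover[OF that, unfolded Bex_def]] by (auto simp: ch_def)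
  define F where "F = restrict (\<lambda>\<xi>. dir_deriv (X \<xi> (lift_chart A (ch \<xi>))) (local_rep A Q (ch \<xi>))
    (snd (lift_chart A (ch \<xi>)) \<xi>) / (2 * Q \<xi>)) D"
  have "q F"
    unfolding q
  proof (intro conjI ballI)
    show "F \<in> extensional D" by (simp add: F_def)
    fix c z assume c: "c \<in> A" and z: "z \<in> coord_dom A D c"
    from c z obtain \<xi> where \<xi>: "\<xi> \<in> D" "\<xi> \<in> fst (lift_chart A c)" "z = snd (lift_chart A c) \<xi>"
      by (rule coord_domE)
    show "local_rep A F c z = delta0 (spray_coeff A X c) (local_rep A Q c) z / (2 * local_rep A Q c z)"
      unfolding \<xi>(3) local_rep_chart[OF c \<xi>(2)] delta0_spray[OF X Q c \<xi>(1,2)]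
        dir_deriv_chart_independent[OF X Q c ch(1)[OF \<xi>(1)] \<xi>(1,2) ch(2)[OF \<xi>(1)]]
      by (simp add: F_def \<xi>(1))
  qed
  moreover have "F' = F" if "q F'" for F'
  proof
    fix \<xi>
    show "F' \<xi> = F \<xi>"
    proof (cases "\<xi> \<in> D")
      case True
      then obtain c where c: "c \<in> A" "\<xi> \<in> fst (lift_chart A c)" using region_cover by blast
      have "local_rep A F' c (snd (lift_chart A c) \<xi>) = local_rep A F c (snd (lift_chart A c) \<xi>)"
        using \<open>q F\<close> that c coord_domI[OF True c(2)] unfolding q by simp
      then show ?thesis by (simp add: local_rep_chart[OF c])
    next
      case False
      have "F' \<in> extensional D" "F \<in> extensional D" using \<open>q F\<close> that unfolding q by blast+
      then show ?thesis using extensional_arb[OF _ False] by metis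
    qed
  qed
  ultimately have "q (THE F. q F)" by (rule theI)
  moreover have "H1 A D X (fun_class D Q) = (THE F. q F)" by (simp add: H1_def q_def)
  ultimately have "q (H1 A D X (fun_class D Q))" by simp
  then show "H1 A D X (fun_class D Q) \<in> extensional D"
    and "\<And>c z. c \<in> A \<Longrightarrow> z \<in> coord_dom A D c \<Longrightarrow>
      local_rep A (H1 A D X (fun_class D Q)) c z =
        delta0 (spray_coeff A X c) (local_rep A Q c) z / (2 * local_rep A Q c z)"
    unfolding q by blast+
qed

lemma H1_eq_iff:
  assumes X: "spray A D X" and Q: "hamel_function A D X Q" and nz: "\<forall>\<xi>\<in>D. Q \<xi> \<noteq> 0"
  shows "H1 A D X (fun_class D Q) = restrict P D \<longleftrightarrow> hamel_system A D X P Q"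
proof -
  have hom: "homogeneous_one A D Q" using Q by (simp add: hamel_function_def)
  note H = H1_fun_class[OF X hom]
  let ?F = "H1 A D X (fun_class D Q)"
  have "?F = restrict P D \<longleftrightarrow> (\<forall>\<xi>\<in>D. ?F \<xi> = P \<xi>)"
    using H(1) by (auto intro: extensionalityI[OF H(1), of "restrict P D"])
  also have "\<dots> \<longleftrightarrow> (\<forall>c\<in>A. \<forall>z\<in>coord_dom A D c. local_rep A ?F c z = local_rep A P c z)"
  proof (intro iffI ballI)
    fix c z assume h: "\<forall>\<xi>\<in>D. ?F \<xi> = P \<xi>" and c: "c \<in> A" and z: "z \<in> coord_dom A D c"
    from c z obtain \<xi> where "\<xi> \<in> D" "\<xi> \<in> fst (lift_chart A c)" "z = snd (lift_chart A c) \<xi>"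
      by (rule coord_domE)
    then show "local_rep A ?F c z = local_rep A P c z" using h by (simp add: local_rep_chart[OF c])
  next
    fix \<xi> assume h: "\<forall>c\<in>A. \<forall>z\<in>coord_dom A D c. local_rep A ?F c z = local_rep A P c z" and \<xi>: "\<xi> \<in> D"
    then obtain c where c: "c \<in> A" "\<xi> \<in> fst (lift_chart A c)" using region_cover by blast
    show "?F \<xi> = P \<xi>"
      using h[rule_format, OF c(1) coord_domI[OF \<xi> c(2)]] by (simp add: local_rep_chart[OF c])
  qed
  also have "\<dots> \<longleftrightarrow> (\<forall>c\<in>A. \<forall>z\<in>coord_dom A D c.
      delta0 (spray_coeff A X c) (local_rep A Q c) z = 2 * local_rep A P c z * local_rep A Q c z)"
  proof (intro ball_cong refl)
    fix c z assume c: "c \<in> A" and z: "z \<in> coord_dom A D c"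
    from c z obtain \<xi> where "\<xi> \<in> D" "\<xi> \<in> fst (lift_chart A c)" "z = snd (lift_chart A c) \<xi>"
      by (rule coord_domE)
    then have "local_rep A Q c z \<noteq> 0" using nz by (simp add: local_rep_chart[OF c])
    then show "local_rep A ?F c z = local_rep A P c z \<longleftrightarrow>
        delta0 (spray_coeff A X c) (local_rep A Q c) z = 2 * local_rep A P c z * local_rep A Q c z"
      by (auto simp: H(2)[OF c z] field_simps)
  qed
  finally show ?thesis using Q by (simp add: hamel_system_def)
qed

end

section \<open>Uniqueness of the solution\<close>

theorem proposition6p13:
  fixes A :: "('m, real ^ 'n) chart set"
    and D :: "('m, real ^ 'n) tangent set"
    and X :: "('m, real ^ 'n) tangent \<Rightarrow> (('m, real ^ 'n) tangent, 'n coords) chart \<Rightarrow> 'n coords"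
    and P Q\<^sub>o :: "('m, real ^ 'n) tangent \<Rightarrow> real"
  assumes "smooth_manifold A"
    and "conical_region A D"
    and "spray A D X"
    and "homogeneous_one A D P"
    and "hamel_system A D X P Q\<^sub>o"
    and "\<exists>\<xi>\<in>D. Q\<^sub>o \<xi> \<noteq> 0"
    and "nonzero_scalar_curvature A D (\<lambda>c z. spray_coeff A X c z + local_rep A P c z *\<^sub>R snd z)"
  shows "(\<forall>Q. hamel_system A D X P Q \<longrightarrow> (\<exists>k. \<forall>\<xi>\<in>D. Q \<xi> = k * Q\<^sub>o \<xi>)) \<and>
    (\<exists>!C. C \<in> hamel_classes A D X \<and> H1 A D X C = restrict P D)"
proof -
  interpret conical_manifold A D using assms(1,2) by unfold_locales
  note X = assms(3) and Qo = assms(5)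
  note zero = hamel_ratio_propagates[OF X assms(4,7)]
  obtain \<xi>\<^sub>0 where \<xi>\<^sub>0: "\<xi>\<^sub>0 \<in> D" "Q\<^sub>o \<xi>\<^sub>0 \<noteq> 0" using assms(6) by blast
  have unique: "\<forall>\<xi>\<in>D. Q \<xi> = (Q \<xi>\<^sub>0 / Q\<^sub>o \<xi>\<^sub>0) * Q\<^sub>o \<xi>" if "hamel_system A D X P Q" for Q
  proof
    fix \<xi> assume "\<xi> \<in> D"
    then show "Q \<xi> = (Q \<xi>\<^sub>0 / Q\<^sub>o \<xi>\<^sub>0) * Q\<^sub>o \<xi>"
      by (rule zero[OF that Qo \<xi>\<^sub>0(1), rotated]) (simp add: \<xi>\<^sub>0)
  qed
  have nz: "\<forall>\<xi>\<in>D. Q\<^sub>o \<xi> \<noteq> 0"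
    using zero[OF Qo Qo, of _ 0 \<xi>\<^sub>0] \<xi>\<^sub>0 by force
  have ham: "hamel_function A D X Q\<^sub>o" using Qo by (simp add: hamel_system_def)
  have "\<exists>!C. C \<in> hamel_classes A D X \<and> H1 A D X C = restrict P D"
  proof (rule ex1I[of _ "fun_class D Q\<^sub>o"])
    show "fun_class D Q\<^sub>o \<in> hamel_classes A D X \<and> H1 A D X (fun_class D Q\<^sub>o) = restrict P D"
      using H1_eq_iff[OF X ham nz] Qo ham nz by (auto simp: hamel_classes_def)
    fix C assume C: "C \<in> hamel_classes A D X \<and> H1 A D X C = restrict P D"
    then obtain Q where Q: "C = fun_class D Q" "hamel_function A D X Q" "\<forall>\<xi>\<in>D. Q \<xi> \<noteq> 0"
      by (auto simp: hamel_classes_def)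
    define k where "k = Q \<xi>\<^sub>0 / Q\<^sub>o \<xi>\<^sub>0"
    have "k \<noteq> 0" using Q(3) \<xi>\<^sub>0 by (simp add: k_def)
    have Qk: "Q \<xi> = k * Q\<^sub>o \<xi>" if "\<xi> \<in> D" for \<xi>
      using unique[of Q] H1_eq_iff[OF X Q(2,3)] C Q(1) that by (simp add: k_def)
    have scale: "restrict (\<lambda>p. a * Q p) D = restrict (\<lambda>p. (a * k) * Q\<^sub>o p) D" for a
      by (rule restrict_ext) (simp add: Qk)
    show "C = fun_class D Q\<^sub>o"
    proof
      show "C \<subseteq> fun_class D Q\<^sub>o"
        unfolding Q(1) fun_class_def scale using \<open>k \<noteq> 0\<close> by force
      show "fun_class D Q\<^sub>o \<subseteq> C"
      proof
        fix f assume "f \<in> fun_class D Q\<^sub>o"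
        then obtain b where "b \<noteq> 0" "f = restrict (\<lambda>p. b * Q\<^sub>o p) D" by (auto simp: fun_class_def)
        then have "f = restrict (\<lambda>p. (b / k) * Q p) D" "b / k \<noteq> 0"
          using \<open>k \<noteq> 0\<close> scale[of "b / k"] by simp_all
        then show "f \<in> C" unfolding Q(1) fun_class_def by blast
      qed
    qed
  qed
  then show ?thesis using unique by blast
qed

end
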